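(* Let $\lambda>0$, $p,q\in[1,\infty]$. For any $\mathbf{Z},\mathbf{X}\in\mathbb{R}^{m\times n}$, $$\|\mathbf{Z}\|_{F_p} + \frac{\lambda}{\delta_{mn}(q,p)}\|\mathbf{X}\|_{F_{q^*}}\leq \max_{\boldsymbol\Delta\in\mathcal{U}_{F_q}} \|\mathbf{Z}+\boldsymbol\Delta(\mathbf{X})\|_{F_p}\leq \|\mathbf{Z}\|_{F_p} + \lambda\,\delta_{mn}(p,q)\|\mathbf{X}\|_{F_{q^*}}.$$ In particular, if $p\neq q$, $p\in(1,\infty)$ and $mn\ge2$, then for any $\mathbf{X}\neq\mathbf{0}$ the upper bound (second inequality) is strict for almost all $\mathbf{Z}$. Further, when $p\neq q$ and $p\in(1,\infty)$, the gap in the lower bound (first inequality) is arbitrarily small for all $\mathbf{X}$; that is, for every $\mathbf{X}$ the infimum over $\mathbf{Z}\in\mathbb{R}^{m\times n}$ of the middle expression minus the left expression equals $0$.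
   Context: For a matrix $\mathbf{A}$, $\|\mathbf{A}\|_{F_p}$ is the entrywise $\ell_p$ norm ($\max_{ij}|A_{ij}|$ if $p=\infty$); $q^*$ is the conjugate exponent, $1/q+1/q^*=1$. $\mathcal{U}_{F_q}$ is the set of linear maps $\boldsymbol\Delta:\mathbb{R}^{m\times n}\to\mathbb{R}^{m\times n}$ with $\|\boldsymbol\Delta\|_{F_q}\le\lambda$, where $\|\boldsymbol\Delta\|_{F_q}$ is the $F_q$ norm of the $mn\times mn$ matrix representing $\boldsymbol\Delta$ in the standard basis of $\mathbb{R}^{m\times n}$. For $k\ge 1$ and $a,b\in[1,\infty]$, $\delta_k(a,b):=\max\{\|\mathbf{u}\|_a:\mathbf{u}\in\mathbb{R}^k,\ \|\mathbf{u}\|_b=1\}$. "Almost all" is with respect to Lebesgue measure on $\mathbb{R}^{m\times n}$. *)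

theory Defs
  imports "HOL-Analysis.Analysis"
begin

definition lp_norm :: "ennreal \<Rightarrow> 'i set \<Rightarrow> ('i \<Rightarrow> real) \<Rightarrow> real" where
  "lp_norm p I x =
     (if p = \<infinity> then Max ((\<lambda>i. \<bar>x i\<bar>) ` I)
      else (\<Sum>i\<in>I. \<bar>x i\<bar> powr enn2real p) powr (1 / enn2real p))"

definition F_norm :: "ennreal \<Rightarrow> real^'n^'m \<Rightarrow> real" where
  "F_norm p A = lp_norm p UNIV (\<lambda>(i, j). A $ i $ j)"

(* Arithmetic in ennreal, where inverse 0 = \<infinity> and inverse \<infinity> = 0. *)
definition conj_exponent :: "ennreal \<Rightarrow> ennreal" where
  "conj_exponent q = inverse (1 - inverse q)"

lemma conj_exponent_iff:
  assumes "1 \<le> q"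
  shows "1 / q + 1 / r = 1 \<longleftrightarrow> r = conj_exponent q"
proof -
  have le: "inverse q \<le> 1"
  proof (cases q)
    case (real x)
    then have "1 \<le> x" using assms by simp
    then show ?thesis using real by (simp add: inverse_ennreal inverse_le_1_iff)
  qed simp
  have inv_inv: "inverse (inverse s) = s" for s :: ennreal
  proof (cases s)
    case (real x)
    then show ?thesis by (cases "x = 0") (auto simp: inverse_ennreal)
  qed simp
  have ne: "inverse q \<noteq> top"
    using le by (metis ennreal_one_neq_top top_unique)
  have "1 / q + 1 / r = 1 \<longleftrightarrow> inverse q + inverse r = 1"
    by (simp add: divide_ennreal_def)
  also have "\<dots> \<longleftrightarrow> inverse r = 1 - inverse q"
    using add_diff_inverse_ennreal[OF le] ne by (metis ennreal_add_diff_cancel_left)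
  also have "\<dots> \<longleftrightarrow> r = inverse (1 - inverse q)"
    by (metis inv_inv)
  finally show ?thesis by (simp add: conj_exponent_def)
qed

definition delta :: "nat \<Rightarrow> ennreal \<Rightarrow> ennreal \<Rightarrow> real" where
  "delta k a b = (SUP u \<in> {u. lp_norm b {..<k} u = 1}. lp_norm a {..<k} u)"

lemma enn2real_ge_1: "1 \<le> enn2real p" if "1 \<le> p" "p \<noteq> \<infinity>"
  using that by (cases p) auto

lemma lp_norm_cong: "(\<And>i. i \<in> I \<Longrightarrow> x i = y i) \<Longrightarrow> lp_norm p I x = lp_norm p I y"
  by (auto simp: lp_norm_def intro!: arg_cong[where f = Max] arg_cong2[where f = "(powr)"] sum.cong image_cong)

lemma continuous_on_lp_norm:
  fixes I :: "'i set"
  assumes "1 \<le> p" "finite I" "I \<noteq> {}"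
  shows "continuous_on UNIV (lp_norm p I)"
proof (cases "p = \<infinity>")
  case True
  have "continuous_on UNIV (\<lambda>x :: 'i \<Rightarrow> real. Max ((\<lambda>i. \<bar>x i\<bar>) ` I))"
    using assms(2,3)
  proof (induction I rule: finite_ne_induct)
    case (singleton i)
    then show ?case by (auto intro!: continuous_intros)
  next
    case (insert i F)
    then have "(\<lambda>x :: 'i \<Rightarrow> real. Max ((\<lambda>i. \<bar>x i\<bar>) ` insert i F)) =
        (\<lambda>x. max \<bar>x i\<bar> (Max ((\<lambda>i. \<bar>x i\<bar>) ` F)))"
      by auto
    with insert show ?case by (auto intro!: continuous_intros)
  qed
  with True show ?thesis by (simp add: lp_norm_def[abs_def])
next
  case False
  have p: "0 < enn2real p" using enn2real_ge_1[OF assms(1) False] by simp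
  have "continuous_on UNIV (\<lambda>x :: 'i \<Rightarrow> real. \<bar>x i\<bar> powr enn2real p)" for i
    using p by (intro continuous_on_powr' continuous_intros) auto
  then have "continuous_on UNIV (\<lambda>x :: 'i \<Rightarrow> real. \<Sum>i\<in>I. \<bar>x i\<bar> powr enn2real p)"
    by (rule continuous_on_sum)
  then have "continuous_on UNIV
      (\<lambda>x :: 'i \<Rightarrow> real. (\<Sum>i\<in>I. \<bar>x i\<bar> powr enn2real p) powr (1 / enn2real p))"
    by (rule continuous_on_powr') (use p in \<open>auto simp: sum_nonneg\<close>)
  with False show ?thesis by (simp add: lp_norm_def[abs_def])
qed

lemma abs_le_1_of_lp_norm_eq_1:
  assumes "1 \<le> p" "finite I" "i \<in> I" "lp_norm p I x = 1"
  shows "\<bar>x i\<bar> \<le> 1"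
proof (cases "p = \<infinity>")
  case True
  then have "Max ((\<lambda>i. \<bar>x i\<bar>) ` I) = 1" using assms(4) by (simp add: lp_norm_def)
  then show ?thesis using assms(2,3) by (metis Max_ge finite_imageI imageI)
next
  case False
  define r where "r = enn2real p"
  have r: "0 < r" using enn2real_ge_1[OF assms(1) False] by (simp add: r_def)
  have eq: "(\<Sum>j\<in>I. \<bar>x j\<bar> powr r) powr (1 / r) = 1"
    using assms(4) False by (simp add: lp_norm_def r_def)
  have nn: "0 \<le> (\<Sum>j\<in>I. \<bar>x j\<bar> powr r)" by (simp add: sum_nonneg)
  have "(\<Sum>j\<in>I. \<bar>x j\<bar> powr r) = ((\<Sum>j\<in>I. \<bar>x j\<bar> powr r) powr (1 / r)) powr r"
    using r nn by (simp add: powr_powr)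
  then have "(\<Sum>j\<in>I. \<bar>x j\<bar> powr r) = 1" by (simp add: eq)
  moreover have "\<bar>x i\<bar> powr r \<le> (\<Sum>j\<in>I. \<bar>x j\<bar> powr r)"
    using assms(2,3) by (intro member_le_sum) auto
  ultimately have "\<bar>x i\<bar> powr r \<le> 1" by simp
  then show ?thesis using r
    by (metis abs_ge_zero gr_one_powr not_le)
qed

(* The supremum defining delta is a maximum. *)
lemma delta_attained:
  assumes "1 \<le> k" "1 \<le> a" "1 \<le> b"
  shows "\<exists>u. lp_norm b {..<k} u = 1 \<and> lp_norm a {..<k} u = delta k a b"
    and "\<And>v. lp_norm b {..<k} v = 1 \<Longrightarrow> lp_norm a {..<k} v \<le> delta k a b"
proof -
  have ne: "{..<k} \<noteq> {}" using assms(1) by (auto simp: lessThan_empty_iff)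
  define K :: "(nat \<Rightarrow> real) set" where
    "K = Pi\<^sub>E UNIV (\<lambda>i. if i < k then {-1..1} else {0})"
  define S where "S = K \<inter> {u. lp_norm b {..<k} u = 1}"
  have "compactin (product_topology (\<lambda>i. euclidean) UNIV) K"
    unfolding K_def by (subst compactin_PiE) auto
  then have "compact K" by (simp add: euclidean_product_topology)
  moreover have "closed {u. lp_norm b {..<k} u = 1}"
    using continuous_on_lp_norm[OF assms(3) finite_lessThan ne]
    by (intro closed_Collect_eq) auto
  ultimately have S: "compact S" unfolding S_def by (rule compact_Int_closed)
  define cut where "cut v = (\<lambda>i. if i < k then v i else 0)" for v :: "nat \<Rightarrow> real"
  have cut: "lp_norm p {..<k} (cut v) = lp_norm p {..<k} v" for p v
    by (rule lp_norm_cong) (simp add: cut_def)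
  have cut_S: "cut v \<in> S" if v: "lp_norm b {..<k} v = 1" for v
    using abs_le_1_of_lp_norm_eq_1[OF assms(3) _ _ v] v cut[of b v]
    by (auto simp: S_def K_def cut_def abs_le_iff minus_le_iff)
  define e :: "nat \<Rightarrow> real" where "e = (\<lambda>i. if i = 0 then 1 else 0)"
  have "lp_norm b {..<k} e = 1"
  proof (cases "b = \<infinity>")
    case True
    have "Max ((\<lambda>i. \<bar>e i\<bar>) ` {..<k}) = 1"
    proof (rule Max_eqI)
      show "1 \<in> (\<lambda>i. \<bar>e i\<bar>) ` {..<k}"
        using assms(1) by (auto simp: e_def intro!: image_eqI[of _ _ 0])
    qed (auto simp: e_def)
    then show ?thesis using True by (simp add: lp_norm_def)
  next
    case False
    have "(\<Sum>i<k. \<bar>e i\<bar> powr enn2real b) = (\<Sum>i<k. if i = 0 then 1 else 0)"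
      by (intro sum.cong) (auto simp: e_def)
    also have "\<dots> = 1" using assms(1) by simp
    finally show ?thesis using False by (simp add: lp_norm_def)
  qed
  then have "S \<noteq> {}" using cut_S by auto
  then obtain u where u: "u \<in> S" "\<And>v. v \<in> S \<Longrightarrow> lp_norm a {..<k} v \<le> lp_norm a {..<k} u"
    using continuous_attains_sup[OF S, of "lp_norm a {..<k}"]
      continuous_on_subset[OF continuous_on_lp_norm[OF assms(2) finite_lessThan ne]]
    by auto
  have max: "lp_norm a {..<k} v \<le> lp_norm a {..<k} u" if "lp_norm b {..<k} v = 1" for v
    using u(2)[OF cut_S[OF that]] by (simp add: cut)
  have u1: "lp_norm b {..<k} u = 1" using u(1) by (simp add: S_def)
  have eq: "delta k a b = lp_norm a {..<k} u"
    unfolding delta_def using u1 max by (intro cSup_eq_maximum) auto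
  show "\<exists>u. lp_norm b {..<k} u = 1 \<and> lp_norm a {..<k} u = delta k a b"
    using eq u1 by auto
  show "lp_norm a {..<k} v \<le> delta k a b" if "lp_norm b {..<k} v = 1" for v
    using max[OF that] eq by simp
qed

(* The matrix of a linear map on m x n matrices, in the basis of matrix units. *)
definition basis_matrix ::
  "(real^'n^'m \<Rightarrow> real^'n^'m) \<Rightarrow> real^('m \<times> 'n)^('m \<times> 'n)" where
  "basis_matrix D =
     (\<chi> r c. D (axis (fst c) (axis (snd c) 1)) $ fst r $ snd r)"

definition uncertainty_set :: "ennreal \<Rightarrow> real \<Rightarrow> (real^'n^'m \<Rightarrow> real^'n^'m) set" where
  "uncertainty_set q l = {D. linear D \<and> F_norm q (basis_matrix D) \<le> l}"

definition worst_case :: "ennreal \<Rightarrow> ennreal \<Rightarrow> real \<Rightarrow> real^'n^'m \<Rightarrow> real^'n^'m \<Rightarrow> real" where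
  "worst_case p q l Z X = (SUP D \<in> uncertainty_set q l. F_norm p (Z + D X))"

end

theory Submission
  imports Defs
begin

text \<open>As \<open>\<Delta>\<close> ranges over the uncertainty set, Hoelder's inequality and its sharpness show that
  \<open>\<Delta>(X)\<close> ranges over the \<open>q\<close>-norm ball of radius \<open>R = \<lambda> \<parallel>X\<parallel>\<^sub>q\<^sub>*\<close>. The upper bound is then the
  triangle inequality, and a perturbation parallel to \<open>Z\<close> gives the lower bound. Equality in the
  upper bound forces (by strict convexity) the attaining \<open>Y\<close> to be proportional to \<open>Z\<close> in absolute
  value and to maximise \<open>\<parallel>Y\<parallel>\<^sub>p / \<parallel>Y\<parallel>\<^sub>q\<close>; two nonzero entries of a maximiser have equal absolute
  value, so \<open>Z\<close> lies on one of four hyperplanes. The gap in the lower bound tends to \<open>0\<close> along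
  \<open>Z = t E\<close> as \<open>t \<rightarrow> \<infinity>\<close>, where \<open>E\<close> is a matrix unit if \<open>p < q\<close> and the all-ones matrix if \<open>p > q\<close>.\<close>

section \<open>Tangent-line and convexity inequalities for real powers\<close>

lemma powr_less_tangent:
  fixes x t :: real
  assumes "0 < t" "t < 1" "0 \<le> x" "x \<noteq> 1"
  shows "x powr t < 1 + t * (x - 1)"
proof (cases "x = 0")
  case False
  \<comment> \<open>\<open>A\<close> is the weighted mean of \<open>x\<close> and \<open>1\<close>.
    Adding \<open>ln y \<le> y - 1\<close> at \<open>y = x / A\<close> and at
    \<open>y = 1 / A\<close> with weights \<open>t\<close> and \<open>1 - t\<close> makes the
    right-hand sides cancel; strictness comes from \<open>1 / A \<noteq> 1\<close>.\<close>
  define A where "A = 1 + t * (x - 1)"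
  have A: "A = t * x + (1 - t)" by (simp add: A_def algebra_simps)
  have "A > 0" using assms by (simp add: A add_nonneg_pos)
  have "1 / A \<noteq> 1" using assms by (simp add: A_def)
  have "t * ln (x / A) \<le> t * (x / A - 1)"
    using assms False \<open>A > 0\<close> by (intro mult_left_mono ln_le_minus_one) auto
  moreover have "ln (1 / A) < 1 / A - 1"
    using \<open>A > 0\<close> \<open>1 / A \<noteq> 1\<close> ln_le_minus_one[of "1 / A"] ln_eq_minus_one[of "1 / A"]
    by (metis order_less_le zero_less_divide_1_iff)
  hence "(1 - t) * ln (1 / A) < (1 - t) * (1 / A - 1)"
    using assms by (intro mult_strict_left_mono) auto
  moreover have "t * (x / A - 1) + (1 - t) * (1 / A - 1) = (t * x + (1 - t)) / A - 1"
    using \<open>A > 0\<close> by (simp add: field_simps)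
  hence "t * (x / A - 1) + (1 - t) * (1 / A - 1) = 0"
    using \<open>A > 0\<close> by (simp flip: A)
  ultimately have "t * ln (x / A) + (1 - t) * ln (1 / A) < 0" by linarith
  hence "t * ln x < ln A"
    using \<open>A > 0\<close> assms False by (simp add: ln_div algebra_simps)
  hence "x powr t < A"
    using \<open>A > 0\<close> assms False by (metis exp_less_cancel_iff exp_ln powr_def)
  then show ?thesis by (simp add: A_def)
qed (use assms in auto)

text \<open>This is the concave case for the exponent \<open>1 / r\<close>, read at the point
  \<open>x powr r\<close>.\<close>

lemma powr_greater_tangent:
  fixes x r :: real
  assumes "1 < r" "0 \<le> x" "x \<noteq> 1"
  shows "1 + r * (x - 1) < x powr r"
proof -
  have "x powr r \<noteq> 1"
    using assms powr_less_mono2[of r x 1] powr_less_mono2[of r 1 x] by (cases x "1 :: real" rule: linorder_cases) auto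
  then have "(x powr r) powr (1 / r) < 1 + 1 / r * (x powr r - 1)"
    using assms by (intro powr_less_tangent) auto
  then have "x - 1 < (x powr r - 1) / r" using assms by (simp add: powr_powr)
  then show ?thesis using assms by (simp add: field_simps)
qed

lemma powr_ge_tangent:
  fixes x r :: real
  assumes "1 \<le> r" "0 \<le> x"
  shows "1 + r * (x - 1) \<le> x powr r"
  using assms powr_greater_tangent[of r x] by (cases "r = 1"; cases "x = 1") auto

text \<open>After division by the mean \<open>m\<close>, the tangent at 1 bounds both powers from
  below, and the linear terms average out because \<open>u / m\<close> and \<open>v / m\<close> have
  weighted mean 1. Since \<open>u \<noteq> v\<close>, the point \<open>u / m\<close> differs from 1,
  which gives strictness.\<close>

lemma powr_convex_combination_less:
  fixes u v t r :: real
  assumes "1 < r" "0 < t" "t < 1" "0 \<le> u" "0 \<le> v" "u \<noteq> v"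
  shows "(t * u + (1 - t) * v) powr r < t * u powr r + (1 - t) * v powr r"
proof -
  define m where "m = t * u + (1 - t) * v"
  have "m > 0"
  proof (cases "u = 0")
    case True
    then show ?thesis using assms by (simp add: m_def)
  next
    case False
    then show ?thesis using assms by (auto simp: m_def intro!: add_pos_nonneg)
  qed
  have "m - u = (1 - t) * (v - u)" by (simp add: m_def algebra_simps)
  then have "u / m \<noteq> 1" using assms \<open>m > 0\<close> by auto
  then have "t * (1 + r * (u / m - 1)) < t * (u / m) powr r"
    using assms \<open>m > 0\<close> by (intro mult_strict_left_mono powr_greater_tangent) auto
  moreover have "(1 - t) * (1 + r * (v / m - 1)) \<le> (1 - t) * (v / m) powr r"
    using assms \<open>m > 0\<close> by (intro mult_left_mono powr_ge_tangent) auto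
  moreover have "t * (1 + r * (u / m - 1)) + (1 - t) * (1 + r * (v / m - 1))
      = 1 - r + r * ((t * u + (1 - t) * v) / m)"
    by (simp add: algebra_simps add_divide_distrib diff_divide_distrib)
  moreover have "(t * u + (1 - t) * v) / m = 1" using \<open>m > 0\<close> by (simp add: m_def)
  ultimately have "1 < t * (u / m) powr r + (1 - t) * (v / m) powr r" by simp
  also have "\<dots> = (t * u powr r + (1 - t) * v powr r) / m powr r"
    using assms \<open>m > 0\<close> by (simp add: powr_divide add_divide_distrib)
  finally show ?thesis using \<open>m > 0\<close> by (simp add: m_def field_simps)
qed

lemma powr_convex_combination_le:
  fixes u v t r :: real
  assumes "1 \<le> r" "0 < t" "t < 1" "0 \<le> u" "0 \<le> v"
  shows "(t * u + (1 - t) * v) powr r \<le> t * u powr r + (1 - t) * v powr r"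
proof (cases "r = 1 \<or> u = v")
  case True
  moreover have "0 \<le> t * u + (1 - t) * v" using assms by simp
  ultimately show ?thesis using assms by (auto simp: algebra_simps)
next
  case False
  then show ?thesis using assms powr_convex_combination_less[of r t u v] by simp
qed

section \<open>Elementary properties of \<open>lp_norm\<close>\<close>

lemma exponent_cases:
  assumes "1 \<le> (p :: ennreal)"
  obtains "p = top" | r where "p = ennreal r" "1 \<le> r"
  using assms by (cases p) auto

lemma lp_norm_infinity: "lp_norm top I x = Max ((\<lambda>i. \<bar>x i\<bar>) ` I)"
  by (simp add: lp_norm_def)

lemma lp_norm_ennreal:
  "0 \<le> r \<Longrightarrow> lp_norm (ennreal r) I x = (\<Sum>i\<in>I. \<bar>x i\<bar> powr r) powr (1 / r)"
  by (simp add: lp_norm_def)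

lemma lp_norm_infinity_le_iff:
  "finite I \<Longrightarrow> I \<noteq> {} \<Longrightarrow> lp_norm top I x \<le> c \<longleftrightarrow> (\<forall>i\<in>I. \<bar>x i\<bar> \<le> c)"
  by (simp add: lp_norm_infinity)

lemma lp_norm_powr:
  "0 < r \<Longrightarrow> lp_norm (ennreal r) I x powr r = (\<Sum>i\<in>I. \<bar>x i\<bar> powr r)"
  by (simp add: lp_norm_ennreal powr_powr sum_nonneg)

lemma powr_le_cancel_base_iff:
  fixes a b r :: real
  assumes "0 < r" "0 \<le> a" "0 \<le> b"
  shows "a powr r \<le> b powr r \<longleftrightarrow> a \<le> b"
  using assms by (meson linorder_not_less order_less_imp_le powr_less_mono2 powr_mono2)

lemma lp_norm_nonneg:
  assumes "finite I" "I \<noteq> {}"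
  shows "0 \<le> lp_norm p I x"
  using assms by (auto simp: lp_norm_def Max_ge_iff)

lemma lp_norm_ennreal_le_iff:
  assumes "0 < r" "0 \<le> c"
  shows "lp_norm (ennreal r) I x \<le> c \<longleftrightarrow> (\<Sum>i\<in>I. \<bar>x i\<bar> powr r) \<le> c powr r"
proof -
  have "0 \<le> lp_norm (ennreal r) I x" using assms by (simp add: lp_norm_ennreal)
  then show ?thesis
    using assms powr_le_cancel_base_iff[of r "lp_norm (ennreal r) I x" c] lp_norm_powr[of r I x]
    by simp
qed

lemma abs_le_lp_norm:
  assumes "1 \<le> p" "finite I" "i \<in> I"
  shows "\<bar>x i\<bar> \<le> lp_norm p I x"
  using assms(1)
proof (cases rule: exponent_cases)
  case 1
  then show ?thesis using assms by (simp add: lp_norm_infinity)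
next
  case (2 r)
  have "\<bar>x i\<bar> powr r \<le> (\<Sum>j\<in>I. \<bar>x j\<bar> powr r)"
    using assms by (intro member_le_sum) auto
  also have "\<dots> = lp_norm p I x powr r" using 2 by (simp add: lp_norm_powr)
  finally show ?thesis
    using 2 by (subst (asm) powr_le_cancel_base_iff) (auto simp: lp_norm_ennreal)
qed

lemma lp_norm_mono:
  assumes "1 \<le> p" "finite I" "I \<noteq> {}" "\<And>i. i \<in> I \<Longrightarrow> \<bar>x i\<bar> \<le> \<bar>y i\<bar>"
  shows "lp_norm p I x \<le> lp_norm p I y"
  using assms(1)
proof (cases rule: exponent_cases)
  case 1
  then show ?thesis using assms abs_le_lp_norm[OF assms(1,2), of _ y]
    by (auto simp: lp_norm_infinity_le_iff intro: order_trans)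
next
  case (2 r)
  have "(\<Sum>i\<in>I. \<bar>x i\<bar> powr r) \<le> (\<Sum>i\<in>I. \<bar>y i\<bar> powr r)"
    using assms 2 by (intro sum_mono powr_mono2) auto
  then show ?thesis using 2 by (auto simp: lp_norm_ennreal sum_nonneg intro!: powr_mono2)
qed

lemma lp_norm_abs: "lp_norm p I (\<lambda>i. \<bar>x i\<bar>) = lp_norm p I x"
  by (simp add: lp_norm_def)

lemma lp_norm_scale:
  assumes "1 \<le> p" "finite I" "I \<noteq> {}"
  shows "lp_norm p I (\<lambda>i. c * x i) = \<bar>c\<bar> * lp_norm p I x"
  using assms(1)
proof (cases rule: exponent_cases)
  case 1
  have "mono ((*) \<bar>c\<bar>)" by (auto intro!: monoI mult_left_mono)
  then show ?thesis using 1 assms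
    by (simp add: lp_norm_infinity mono_Max_commute image_image abs_mult)
next
  case (2 r)
  then show ?thesis
    by (simp add: lp_norm_ennreal abs_mult powr_mult sum_nonneg powr_powr flip: sum_distrib_left)
qed

lemma lp_norm_eq_0_iff:
  assumes "1 \<le> p" "finite I" "I \<noteq> {}"
  shows "lp_norm p I x = 0 \<longleftrightarrow> (\<forall>i\<in>I. x i = 0)"
proof
  assume "lp_norm p I x = 0"
  then show "\<forall>i\<in>I. x i = 0" using abs_le_lp_norm[OF assms(1,2), of _ x] by fastforce
next
  assume "\<forall>i\<in>I. x i = 0"
  then have "lp_norm p I x = lp_norm p I (\<lambda>i. 0 * x i)" by (intro lp_norm_cong) auto
  then show "lp_norm p I x = 0" using lp_norm_scale[OF assms, of 0 x] by simp
qed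

section \<open>Minkowski's inequality and its equality case\<close>

text \<open>Convexity of the power, applied to \<open>\<bar>x\<bar> + \<bar>y\<bar>\<close> written
  as \<open>A + B\<close> times the convex combination of \<open>\<bar>x\<bar> / A\<close> and
  \<open>\<bar>y\<bar> / B\<close> with weights \<open>A / (A + B)\<close> and
  \<open>B / (A + B)\<close>. With \<open>A\<close> and \<open>B\<close> the two norms, summation
  gives the triangle inequality, and the strict version gives its equality case.\<close>

lemma Minkowski_summand_le:
  fixes x y A B r :: real
  assumes "1 \<le> r" "0 < A" "0 < B"
  defines "b \<equiv> (A + B) powr r * (A / (A + B) * (\<bar>x\<bar> / A) powr r + B / (A + B) * (\<bar>y\<bar> / B) powr r)"
  shows "\<bar>x + y\<bar> powr r \<le> b"
    and "1 < r \<Longrightarrow> \<bar>x\<bar> / A \<noteq> \<bar>y\<bar> / B \<Longrightarrow> \<bar>x + y\<bar> powr r < b"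
proof -
  define t where "t = A / (A + B)"
  have t: "0 < t" "t < 1" and t': "B / (A + B) = 1 - t"
    using assms by (auto simp: t_def field_simps)
  have "\<bar>x + y\<bar> powr r \<le> (\<bar>x\<bar> + \<bar>y\<bar>) powr r"
    using assms by (intro powr_mono2) auto
  also have "\<bar>x\<bar> + \<bar>y\<bar> = (A + B) * (t * (\<bar>x\<bar> / A) + (1 - t) * (\<bar>y\<bar> / B))"
  proof -
    have "(A + B) * t = A" "(A + B) * (1 - t) = B"
      unfolding t'[symmetric] using assms(2,3) by (simp_all add: t_def)
    then have "(A + B) * (t * (\<bar>x\<bar> / A)) = \<bar>x\<bar>" "(A + B) * ((1 - t) * (\<bar>y\<bar> / B)) = \<bar>y\<bar>"
      using assms(2,3) by (simp_all flip: mult.assoc)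
    then show ?thesis by (simp only: distrib_left)
  qed
  also have "\<dots> powr r = (A + B) powr r * (t * (\<bar>x\<bar> / A) + (1 - t) * (\<bar>y\<bar> / B)) powr r"
    using assms t by (simp add: powr_mult)
  finally have *: "\<bar>x + y\<bar> powr r \<le> \<dots>" .
  also have "\<dots> \<le> (A + B) powr r * (t * (\<bar>x\<bar> / A) powr r + (1 - t) * (\<bar>y\<bar> / B) powr r)"
    using assms t by (intro mult_left_mono powr_convex_combination_le) auto
  finally show "\<bar>x + y\<bar> powr r \<le> b" unfolding b_def t' by (simp add: t_def)
  assume "1 < r" "\<bar>x\<bar> / A \<noteq> \<bar>y\<bar> / B"
  then have "(A + B) powr r * (t * (\<bar>x\<bar> / A) + (1 - t) * (\<bar>y\<bar> / B)) powr r
     < (A + B) powr r * (t * (\<bar>x\<bar> / A) powr r + (1 - t) * (\<bar>y\<bar> / B) powr r)"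
    using assms t by (intro mult_strict_left_mono powr_convex_combination_less) auto
  with * show "\<bar>x + y\<bar> powr r < b" unfolding b_def t' by (simp add: t_def)
qed

text \<open>Each normalised family has power sum 1, so the weighted sum of the two is 1 as
  well.\<close>

lemma Minkowski_sum_bound:
  fixes x y :: "'i \<Rightarrow> real" and I :: "'i set"
  assumes "1 \<le> r"
  defines "A \<equiv> lp_norm (ennreal r) I x" and "B \<equiv> lp_norm (ennreal r) I y"
  assumes "0 < A" "0 < B"
  shows "(\<Sum>i\<in>I. (A + B) powr r *
      (A / (A + B) * (\<bar>x i\<bar> / A) powr r + B / (A + B) * (\<bar>y i\<bar> / B) powr r)) = (A + B) powr r"
proof -
  have "(\<Sum>i\<in>I. (\<bar>x i\<bar> / A) powr r) = 1" "(\<Sum>i\<in>I. (\<bar>y i\<bar> / B) powr r) = 1"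
    using assms lp_norm_powr[of r I x] lp_norm_powr[of r I y]
    by (auto simp: powr_divide simp flip: sum_divide_distrib)
  moreover have "A / (A + B) + B / (A + B) = 1"
    using assms(4,5) by (simp flip: add_divide_distrib)
  ultimately show ?thesis by (simp only: sum.distrib mult_1_right flip: sum_distrib_left)
qed

lemma lp_norm_triangle:
  assumes "1 \<le> p" "finite I" "I \<noteq> {}"
  shows "lp_norm p I (\<lambda>i. x i + y i) \<le> lp_norm p I x + lp_norm p I y"
  using assms(1)
proof (cases rule: exponent_cases)
  case 1
  have "\<bar>x i + y i\<bar> \<le> lp_norm p I x + lp_norm p I y" if "i \<in> I" for i
    using abs_le_lp_norm[OF assms(1,2) that, of x] abs_le_lp_norm[OF assms(1,2) that, of y]
    by linarith
  then show ?thesis using 1 assms by (simp add: lp_norm_infinity_le_iff)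
next
  case (2 r)
  define A where "A = lp_norm p I x"
  define B where "B = lp_norm p I y"
  have AB: "0 \<le> A" "0 \<le> B" using assms by (auto simp: A_def B_def lp_norm_nonneg)
  \<comment> \<open>The convexity argument divides by both norms, so a vanishing norm is treated
    separately.\<close>
  consider "A = 0" | "B = 0" | "0 < A" "0 < B" using AB by fastforce
  then show ?thesis
  proof cases
    case 1
    then have "\<forall>i\<in>I. x i = 0" using lp_norm_eq_0_iff[OF assms, of x] by (simp add: A_def)
    then have "lp_norm p I (\<lambda>i. x i + y i) = lp_norm p I y" by (intro lp_norm_cong) auto
    then show ?thesis using AB(1) by (simp add: A_def)
  next
    case 2
    then have "\<forall>i\<in>I. y i = 0" using lp_norm_eq_0_iff[OF assms, of y] by (simp add: B_def)
    then have "lp_norm p I (\<lambda>i. x i + y i) = lp_norm p I x" by (intro lp_norm_cong) auto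
    then show ?thesis using AB(2) by (simp add: B_def)
  next
    case 3
    have "(\<Sum>i\<in>I. \<bar>x i + y i\<bar> powr r) \<le> (\<Sum>i\<in>I. (A + B) powr r *
        (A / (A + B) * (\<bar>x i\<bar> / A) powr r + B / (A + B) * (\<bar>y i\<bar> / B) powr r))"
      using 2 3 by (intro sum_mono Minkowski_summand_le) auto
    also have "\<dots> = (A + B) powr r"
      using 2 3 Minkowski_sum_bound[of r I x y] by (simp add: A_def B_def)
    finally show ?thesis
      using 2 3 unfolding \<open>p = ennreal r\<close> A_def B_def by (subst lp_norm_ennreal_le_iff) auto
  qed
qed

text \<open>A single index with different normalised entries would make one summand bound, and hence
  the triangle inequality, strict.\<close>

lemma lp_norm_triangle_eqD:
  fixes x y :: "'i \<Rightarrow> real" and I :: "'i set"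
  assumes "1 < r" "finite I" "i \<in> I"
  defines "A \<equiv> lp_norm (ennreal r) I x" and "B \<equiv> lp_norm (ennreal r) I y"
  assumes "0 < A" "0 < B" "lp_norm (ennreal r) I (\<lambda>i. x i + y i) = A + B"
  shows "\<bar>x i\<bar> / A = \<bar>y i\<bar> / B"
proof (rule ccontr)
  assume "\<bar>x i\<bar> / A \<noteq> \<bar>y i\<bar> / B"
  then have "(\<Sum>i\<in>I. \<bar>x i + y i\<bar> powr r) < (\<Sum>i\<in>I. (A + B) powr r *
      (A / (A + B) * (\<bar>x i\<bar> / A) powr r + B / (A + B) * (\<bar>y i\<bar> / B) powr r))"
    using assms(1-3,6,7) by (intro sum_strict_mono_ex1 ballI bexI[of _ i] Minkowski_summand_le) auto
  also have "\<dots> = (A + B) powr r"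
    using assms(1,6,7) Minkowski_sum_bound[of r I x y] by (simp add: A_def B_def)
  also have "\<dots> = (\<Sum>i\<in>I. \<bar>x i + y i\<bar> powr r)"
    using assms(1) lp_norm_powr[of r I "\<lambda>i. x i + y i"] assms(8) by simp
  finally show False by simp
qed

section \<open>Estimates for \<open>delta\<close> as a comparison constant between norms\<close>

lemma lp_norm_one: "lp_norm 1 I x = (\<Sum>i\<in>I. \<bar>x i\<bar>)"
  by (simp add: lp_norm_def sum_nonneg)

lemma lp_norm_reindex:
  assumes "bij_betw h J I"
  shows "lp_norm p J (\<lambda>j. x (h j)) = lp_norm p I x"
proof -
  have "(\<lambda>j. \<bar>x (h j)\<bar>) ` J = (\<lambda>i. \<bar>x i\<bar>) ` I"
    using bij_betw_imp_surj_on[OF assms] by (auto simp: image_image[symmetric])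
  then show ?thesis
    using sum.reindex_bij_betw[OF assms, of "\<lambda>i. \<bar>x i\<bar> powr enn2real p"] by (simp add: lp_norm_def)
qed

text \<open>Normalising in the \<open>b\<close>-norm and reindexing along a bijection with
  \<open>{..<k}\<close> reduces this to the maximality of \<open>delta\<close>, which is thereby
  available on any finite index set, in particular on matrix positions.\<close>

lemma lp_norm_le_delta:
  assumes "finite I" "I \<noteq> {}" "1 \<le> a" "1 \<le> b"
  shows "lp_norm a I x \<le> delta (card I) a b * lp_norm b I x"
proof (cases "lp_norm b I x = 0")
  case True
  then have "lp_norm a I x = 0" using assms by (simp add: lp_norm_eq_0_iff)
  with True show ?thesis by simp
next
  case False
  define k where "k = card I"
  have k: "1 \<le> k" using assms by (simp add: k_def Suc_le_eq card_gt_0_iff)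
  define B where "B = lp_norm b I x"
  have B: "0 < B" using False assms lp_norm_nonneg[of I b x] by (simp add: B_def)
  obtain h where h: "bij_betw h {..<k} I"
    using ex_bij_betw_nat_finite[OF assms(1)] by (auto simp: k_def lessThan_atLeast0)
  define u where "u = (\<lambda>j. (1 / B) * x (h j))"
  have u: "lp_norm p {..<k} u = lp_norm p I x / B" if "1 \<le> p" for p
    using that B k unfolding u_def
    by (subst lp_norm_scale) (auto simp: lp_norm_reindex[OF h] lessThan_empty_iff)
  have "lp_norm b {..<k} u = 1" using u[OF assms(4)] B by (simp add: B_def)
  then have "lp_norm a {..<k} u \<le> delta k a b"
    using delta_attained(2)[OF k assms(3,4)] by simp
  then show ?thesis using u[OF assms(3)] B by (simp add: B_def k_def field_simps)
qed

lemma delta_le_if: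
  assumes "1 \<le> k" "1 \<le> a" "1 \<le> b"
    and "\<And>u. lp_norm b {..<k} u = 1 \<Longrightarrow> lp_norm a {..<k} u \<le> c"
  shows "delta k a b \<le> c"
  using delta_attained(1)[OF assms(1-3)] assms(4) by metis

text \<open>A vector of \<open>b\<close>-norm 1 is nonzero and so has nonzero \<open>a\<close>-norm.
  This justifies dividing by \<open>delta\<close> in the lower bound.\<close>

lemma delta_pos:
  assumes "1 \<le> k" "1 \<le> a" "1 \<le> b"
  shows "0 < delta k a b"
proof -
  have ne: "{..<k} \<noteq> {}" using assms(1) by (auto simp: lessThan_empty_iff)
  obtain u where u: "lp_norm b {..<k} u = 1" "lp_norm a {..<k} u = delta k a b"
    using delta_attained(1)[OF assms] by blast
  have "lp_norm a {..<k} u \<noteq> 0"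
    using u(1) lp_norm_eq_0_iff[OF assms(2) finite_lessThan ne, of u]
      lp_norm_eq_0_iff[OF assms(3) finite_lessThan ne, of u] by auto
  then show ?thesis using u(2) lp_norm_nonneg[OF finite_lessThan ne, of a u] by simp
qed

lemma lp_norm_ennreal_le_1_iff:
  assumes "1 \<le> r"
  shows "lp_norm (ennreal r) I x \<le> 1 \<longleftrightarrow> (\<Sum>i\<in>I. \<bar>x i\<bar> powr r) \<le> 1"
  using assms lp_norm_ennreal_le_iff[of r 1] by simp

text \<open>The entries of a unit vector are at most 1 in absolute value, so raising the exponent
  does not increase their powers.\<close>

lemma delta_le_1:
  assumes "1 \<le> k" "1 \<le> p" "p \<le> q"
  shows "delta k q p \<le> 1"
proof (rule delta_le_if)
  fix u assume u: "lp_norm p {..<k} u = 1"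
  have ne: "{..<k} \<noteq> {}" using assms(1) by (auto simp: lessThan_empty_iff)
  have le: "\<bar>u i\<bar> \<le> 1" if "i < k" for i
    using abs_le_1_of_lp_norm_eq_1[OF assms(2) _ _ u] that by auto
  show "lp_norm q {..<k} u \<le> 1"
  proof (cases "q = top")
    case True
    then show ?thesis using le ne by (simp add: lp_norm_infinity_le_iff)
  next
    case False
    then have "p \<noteq> top" using assms by (metis top.extremum_unique)
    then obtain a where a: "p = ennreal a" "1 \<le> a"
      using assms(2) by (cases p) auto
    obtain b where b: "q = ennreal b" "1 \<le> b"
      using order_trans[OF assms(2,3)] False by (cases q) auto
    have "a \<le> b" using assms a b by simp
    have "(\<Sum>i<k. \<bar>u i\<bar> powr b) \<le> (\<Sum>i<k. \<bar>u i\<bar> powr a)"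
      using le \<open>a \<le> b\<close> by (intro sum_mono powr_mono') auto
    also have "\<dots> = 1" using lp_norm_powr[of a "{..<k}" u] a u by simp
    finally show ?thesis using b by (simp add: lp_norm_ennreal_le_1_iff)
  qed
qed (use assms in auto)

text \<open>The power mean inequality; it yields the bound on \<open>delta\<close> for a smaller
  against a larger exponent, and later controls the sum of the entries of a perturbation.\<close>

lemma power_mean_lp_norm:
  assumes "1 \<le> a" "a \<le> b" "finite I" "I \<noteq> {}"
  shows "lp_norm (ennreal a) I x \<le> card I powr (1 / a - 1 / b) * lp_norm (ennreal b) I x"
proof -
  define k where "k = real (card I)"
  have k: "0 < k" using assms by (simp add: k_def card_gt_0_iff)
  define m where "m = (\<Sum>i\<in>I. \<bar>x i\<bar> powr a) / k"
  have "0 \<le> m" using k by (simp add: m_def sum_nonneg)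
  have km: "(\<Sum>i\<in>I. \<bar>x i\<bar> powr a) = k * m" using k by (simp add: m_def)
  show ?thesis
  proof (cases "m = 0")
    case True
    then have "lp_norm (ennreal a) I x = 0" using assms km by (simp add: lp_norm_ennreal)
    then show ?thesis using assms lp_norm_nonneg[OF assms(3,4), of "ennreal b" x] by simp
  next
    case False
    with \<open>0 \<le> m\<close> have m: "0 < m" by simp
    define r where "r = b / a"
    have r: "1 \<le> r" using assms by (simp add: r_def)
    \<comment> \<open>Since \<open>m\<close> is the mean of the \<open>a\<close>-th powers, the
      numbers \<open>\<bar>x i\<bar> powr a / m\<close> have mean 1 and the linear terms of the
      tangents sum to zero.\<close>
    have "(\<Sum>i\<in>I. 1 + r * (\<bar>x i\<bar> powr a / m - 1)) \<le> (\<Sum>i\<in>I. (\<bar>x i\<bar> powr a / m) powr r)"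
      using r m by (intro sum_mono powr_ge_tangent) auto
    also have "(\<Sum>i\<in>I. 1 + r * (\<bar>x i\<bar> powr a / m - 1))
        = k + r * ((\<Sum>i\<in>I. \<bar>x i\<bar> powr a) / m - k)"
      by (simp add: sum.distrib sum_subtractf k_def flip: sum_distrib_left sum_divide_distrib)
    also have "\<dots> = k" using m by (simp add: km)
    also have "(\<Sum>i\<in>I. (\<bar>x i\<bar> powr a / m) powr r) = (\<Sum>i\<in>I. \<bar>x i\<bar> powr b) / m powr r"
      using m assms by (simp add: powr_divide powr_powr r_def flip: sum_divide_distrib)
    finally have "k * m powr r \<le> (\<Sum>i\<in>I. \<bar>x i\<bar> powr b)" using m by (simp add: field_simps)
    then have "(k * m powr r) powr (1 / b) \<le> lp_norm (ennreal b) I x"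
      using assms k m by (simp add: lp_norm_ennreal powr_mono2)
    moreover have "(k * m powr r) powr (1 / b) = k powr (1 / b) * m powr (1 / a)"
      using assms k m by (simp add: powr_mult powr_powr r_def)
    ultimately have "k powr (1 / a - 1 / b) * (k powr (1 / b) * m powr (1 / a))
        \<le> k powr (1 / a - 1 / b) * lp_norm (ennreal b) I x"
      by (intro mult_left_mono) auto
    moreover have "k powr (1 / a - 1 / b) * (k powr (1 / b) * m powr (1 / a)) = lp_norm (ennreal a) I x"
      using assms k m
      by (simp add: lp_norm_ennreal km powr_mult flip: mult.assoc powr_add)
    ultimately show ?thesis by (simp add: k_def)
  qed
qed

lemma delta_le_powr:
  assumes "1 \<le> k" "1 \<le> a" "a \<le> b"
  shows "delta k (ennreal a) (ennreal b) \<le> k powr (1 / a - 1 / b)"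
proof (rule delta_le_if)
  fix u assume "lp_norm (ennreal b) {..<k} u = 1"
  moreover have "{..<k} \<noteq> {}" using assms(1) by (auto simp: lessThan_empty_iff)
  ultimately show "lp_norm (ennreal a) {..<k} u \<le> k powr (1 / a - 1 / b)"
    using power_mean_lp_norm[OF assms(2,3) finite_lessThan, of k u] by simp
qed (use assms in auto)

section \<open>Conjugate exponents, Hoelder's inequality and its sharpness\<close>

lemma conj_exponent_top: "conj_exponent top = 1"
  by (simp add: conj_exponent_def)

lemma conj_exponent_1: "conj_exponent 1 = top"
  by (simp add: conj_exponent_def)

lemma conj_exponent_ennreal:
  assumes "1 < r"
  shows "conj_exponent (ennreal r) = ennreal (r / (r - 1))"
proof -
  have "1 - inverse (ennreal r) = ennreal (1 - 1 / r)"
    using assms by (simp add: inverse_ennreal ennreal_minus divide_inverse flip: ennreal_1)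
  moreover have "inverse (1 - 1 / r) = r / (r - 1)" "0 < 1 - 1 / r"
    using assms by (auto simp: field_simps)
  ultimately show ?thesis by (simp add: conj_exponent_def inverse_ennreal)
qed

lemma conj_exponent_cases:
  assumes "1 \<le> q"
  obtains "q = top" "conj_exponent q = 1" | "q = 1" "conj_exponent q = top"
  | r s where "q = ennreal r" "conj_exponent q = ennreal s" "1 < r" "1 < s" "1 / r + 1 / s = 1"
  using assms
proof (cases rule: exponent_cases)
  case 1
  then show ?thesis using that(1) conj_exponent_top by simp
next
  case (2 r)
  show ?thesis
  proof (cases "r = 1")
    case True
    then show ?thesis using that(2) 2 conj_exponent_1 by simp
  next
    case False
    then show ?thesis using that(3)[of r "r / (r - 1)"] 2 conj_exponent_ennreal[of r]
      by (simp add: field_simps)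
  qed
qed

lemma conj_exponent_ge_1: "1 \<le> q \<Longrightarrow> 1 \<le> conj_exponent q"
  by (erule conj_exponent_cases) auto

lemma Holder_sum_1_top:
  assumes "finite I"
  shows "\<bar>\<Sum>i\<in>I. m i * x i\<bar> \<le> lp_norm top I m * lp_norm 1 I x"
proof -
  have "\<bar>\<Sum>i\<in>I. m i * x i\<bar> \<le> (\<Sum>i\<in>I. \<bar>m i * x i\<bar>)" by (rule sum_abs)
  also have "\<dots> \<le> (\<Sum>i\<in>I. lp_norm top I m * \<bar>x i\<bar>)"
    using assms by (auto simp: abs_mult intro!: sum_mono mult_right_mono abs_le_lp_norm)
  finally show ?thesis by (simp add: lp_norm_one sum_distrib_left)
qed

lemma Holder_sum:
  assumes "1 \<le> q" "finite I" "I \<noteq> {}"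
  shows "\<bar>\<Sum>i\<in>I. m i * x i\<bar> \<le> lp_norm q I m * lp_norm (conj_exponent q) I x"
  using assms(1)
proof (cases rule: conj_exponent_cases)
  case 1
  then show ?thesis using Holder_sum_1_top[OF assms(2)] by simp
next
  case 2
  then show ?thesis using Holder_sum_1_top[OF assms(2), of x m] by (simp add: mult.commute)
next
  case (3 r s)
  define A where "A = lp_norm (ennreal r) I m"
  define B where "B = lp_norm (ennreal s) I x"
  have AB: "0 \<le> A" "0 \<le> B" using assms by (auto simp: A_def B_def lp_norm_nonneg)
  show ?thesis
  proof (cases "A = 0 \<or> B = 0")
    case True
    then have "\<forall>i\<in>I. m i * x i = 0"
      using lp_norm_eq_0_iff[of "ennreal r" I m] lp_norm_eq_0_iff[of "ennreal s" I x] assms 3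
      by (auto simp: A_def B_def)
    then have "(\<Sum>i\<in>I. m i * x i) = 0" by (rule sum.neutral)
    then show ?thesis using True 3 by (auto simp: A_def B_def)
  next
    case False
    then have pos: "0 < A" "0 < B" using AB by auto
    have "\<bar>\<Sum>i\<in>I. m i * x i\<bar> \<le> (\<Sum>i\<in>I. \<bar>m i * x i\<bar>)" by (rule sum_abs)
    also have "\<dots> = A * B * (\<Sum>i\<in>I. (\<bar>m i\<bar> / A) * (\<bar>x i\<bar> / B))"
      using pos by (simp add: abs_mult sum_distrib_left)
    \<comment> \<open>Young's inequality on the normalised entries: both power sums are 1, so the
      bound totals \<open>1 / r + 1 / s = 1\<close>.\<close>
    also have "\<dots> \<le> A * B * (\<Sum>i\<in>I. (\<bar>m i\<bar> / A) powr r / r + (\<bar>x i\<bar> / B) powr s / s)"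
      using pos 3 by (intro mult_left_mono sum_mono Youngs_inequality) auto
    also have "(\<Sum>i\<in>I. (\<bar>m i\<bar> / A) powr r / r + (\<bar>x i\<bar> / B) powr s / s)
        = A powr r / A powr r / r + B powr s / B powr s / s"
      using pos 3 lp_norm_powr[of r I m] lp_norm_powr[of s I x]
      by (simp add: sum.distrib powr_divide A_def B_def flip: sum_divide_distrib)
    also have "\<dots> = 1" using pos 3 by simp
    finally show ?thesis using 3 by (simp add: A_def B_def)
  qed
qed

text \<open>Sharpness of Hoelder's inequality. The extremal vector consists of the signs of
  \<open>x\<close> if \<open>q\<close> is infinite, is a signed unit vector at a largest entry if
  \<open>q = 1\<close>, and otherwise is the signed power \<open>s - 1\<close> of
  \<open>\<bar>x\<bar> / B\<close>. The norm is only bounded by 1 because these choices vanish when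
  \<open>x\<close> does.\<close>

lemma lp_norm_dual_attained:
  fixes x :: "'i \<Rightarrow> real"
  assumes "1 \<le> q" "finite I" "I \<noteq> {}"
  shows "\<exists>v. lp_norm q I v \<le> 1 \<and> (\<Sum>i\<in>I. v i * x i) = lp_norm (conj_exponent q) I x"
  using assms(1)
proof (cases rule: conj_exponent_cases)
  case 1
  have "lp_norm q I (\<lambda>i. sgn (x i)) \<le> 1"
    using 1 assms by (simp add: lp_norm_infinity_le_iff abs_sgn_eq)
  moreover have "(\<Sum>i\<in>I. sgn (x i) * x i) = lp_norm (conj_exponent q) I x"
    using 1 by (auto simp: lp_norm_one sgn_if intro!: sum.cong)
  ultimately show ?thesis by blast
next
  case 2
  have "lp_norm top I x \<in> (\<lambda>i. \<bar>x i\<bar>) ` I"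
    using assms unfolding lp_norm_infinity by (intro Max_in) auto
  then obtain i where i: "i \<in> I" "lp_norm top I x = \<bar>x i\<bar>" by auto
  define v where "v = (\<lambda>j. if j = i then sgn (x i) else 0)"
  have "(\<Sum>j\<in>I. \<bar>v j\<bar>) = (\<Sum>j\<in>I. if j = i then \<bar>sgn (x i)\<bar> else 0)"
    by (intro sum.cong) (auto simp: v_def)
  then have "lp_norm 1 I v \<le> 1" using i assms by (simp add: lp_norm_one abs_sgn_eq)
  moreover have "(\<Sum>j\<in>I. v j * x j) = (\<Sum>j\<in>I. if j = i then sgn (x i) * x i else 0)"
    by (intro sum.cong) (auto simp: v_def)
  then have "(\<Sum>j\<in>I. v j * x j) = \<bar>x i\<bar>" using i assms by (simp add: sgn_if)
  ultimately show ?thesis using 2 i by auto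
next
  case (3 r s)
  define B where "B = lp_norm (ennreal s) I x"
  have "0 \<le> B" using assms by (simp add: B_def lp_norm_nonneg)
  show ?thesis
  proof (cases "B = 0")
    case True
    then show ?thesis using 3 assms lp_norm_eq_0_iff[OF assms, of "\<lambda>_. 0"]
      by (intro exI[of _ "\<lambda>_. 0"]) (auto simp: B_def)
  next
    case False
    with \<open>0 \<le> B\<close> have B: "0 < B" by simp
    define v where "v = (\<lambda>i. sgn (x i) * (\<bar>x i\<bar> / B) powr (s - 1))"
    \<comment> \<open>Conjugacy turns the \<open>r\<close>-th powers of \<open>v\<close> into the
      \<open>s\<close>-th powers of \<open>\<bar>x\<bar> / B\<close>, whose sum is 1.\<close>
    have rs: "(s - 1) * r = s" using 3 by (simp add: field_simps)
    have "(\<Sum>i\<in>I. (\<bar>x i\<bar> / B) powr s) = B powr s / B powr s"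
      using B 3 lp_norm_powr[of s I x] by (simp add: powr_divide B_def flip: sum_divide_distrib)
    then have sum1: "(\<Sum>i\<in>I. (\<bar>x i\<bar> / B) powr s) = 1" using B by simp
    have "\<bar>v i\<bar> powr r = (\<bar>x i\<bar> / B) powr s" for i
      using B 3 rs by (cases "x i = 0") (auto simp: v_def abs_mult abs_sgn_eq powr_powr)
    then have "lp_norm q I v \<le> 1" using 3 sum1 by (simp add: lp_norm_ennreal_le_1_iff)
    moreover have "v i * x i = B * (\<bar>x i\<bar> / B) powr s" for i
    proof (cases "x i = 0")
      case False
      have "v i * x i = (\<bar>x i\<bar> / B) powr (s - 1) * \<bar>x i\<bar>"
        by (simp add: v_def sgn_if)
      also have "\<dots> = B * ((\<bar>x i\<bar> / B) powr 1 * (\<bar>x i\<bar> / B) powr (s - 1))"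
        using B by simp
      also have "(\<bar>x i\<bar> / B) powr 1 * (\<bar>x i\<bar> / B) powr (s - 1) = (\<bar>x i\<bar> / B) powr s"
        by (simp only: powr_add[symmetric] add_diff_cancel_left' diff_add_cancel add.commute[of 1])
      finally show ?thesis .
    qed (use 3 in auto)
    then have "(\<Sum>i\<in>I. v i * x i) = B" using sum1 by (simp flip: sum_distrib_left)
    ultimately show ?thesis using 3 by (auto simp: B_def)
  qed
qed

text \<open>Computing the norm row by row allows Hoelder's inequality to be used in each row of the
  matrix of a linear map, and makes the norm of an outer product factor.\<close>

lemma lp_norm_Times:
  assumes "1 \<le> q" "finite A" "A \<noteq> {}" "finite B" "B \<noteq> {}"
  shows "lp_norm q (A \<times> B) (\<lambda>(i, j). M i j) = lp_norm q A (\<lambda>i. lp_norm q B (M i))"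
  using assms(1)
proof (cases rule: exponent_cases)
  case 1
  \<comment> \<open>Two reals with the same upper bounds are equal.\<close>
  have "lp_norm top (A \<times> B) (\<lambda>(i, j). M i j) \<le> c \<longleftrightarrow> lp_norm top A (\<lambda>i. lp_norm top B (M i)) \<le> c" for c
    using assms by (simp add: lp_norm_infinity_le_iff lp_norm_nonneg)
  then show ?thesis using 1 by (metis order_antisym order_refl)
next
  case (2 r)
  have "(\<Sum>z\<in>A \<times> B. \<bar>case z of (i, j) \<Rightarrow> M i j\<bar> powr r) = (\<Sum>(i, j)\<in>A \<times> B. \<bar>M i j\<bar> powr r)"
    by (intro sum.cong) auto
  also have "\<dots> = (\<Sum>i\<in>A. \<Sum>j\<in>B. \<bar>M i j\<bar> powr r)" by (simp add: sum.cartesian_product)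
  also have "\<dots> = (\<Sum>i\<in>A. \<bar>lp_norm q B (M i)\<bar> powr r)"
    using 2 assms by (intro sum.cong) (auto simp: lp_norm_powr lp_norm_nonneg)
  finally show ?thesis using 2 by (simp add: lp_norm_ennreal)
qed

section \<open>Vectors that maximise the ratio of two norms\<close>

text \<open>For \<open>r < 1\<close> strict concavity favours two equal shares; for
  \<open>r > 1\<close> strict superadditivity favours putting everything into one share.\<close>

lemma powr_sum_rebalance:
  fixes S T r :: real
  assumes "0 < S" "0 < T" "S \<noteq> T" "0 < r" "r \<noteq> 1"
  obtains S' T' where "0 \<le> S'" "0 \<le> T'" "S' + T' = S + T"
    "S powr r + T powr r < S' powr r + T' powr r"
proof (cases "r < 1")
  case True
  define m where "m = (S + T) / 2"
  have m: "0 < m" using assms by (simp add: m_def)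
  have "S / m \<noteq> 1" "T / m \<noteq> 1" using assms m by (auto simp: m_def)
  then have "(S / m) powr r < 1 + r * (S / m - 1)" "(T / m) powr r < 1 + r * (T / m - 1)"
    using assms m True by (auto intro!: powr_less_tangent)
  then have "(S / m) powr r + (T / m) powr r < 2 + r * (S / m + T / m - 2)"
    by (simp add: algebra_simps)
  also have "S / m + T / m = (S + T) / m" by (simp add: add_divide_distrib)
  also have "S + T = 2 * m" by (simp add: m_def)
  also have "2 * m / m = 2" using m by simp
  finally have "(S powr r + T powr r) / m powr r < 2"
    using assms m by (simp add: powr_divide add_divide_distrib)
  then have "S powr r + T powr r < m powr r + m powr r" using m by (simp add: field_simps)
  with m show ?thesis by (intro that[of m m]) (auto simp: m_def)
next
  case False
  then have "1 < r" using assms by simp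
  define m where "m = S + T"
  have m: "0 < m" using assms by (simp add: m_def)
  have "(S / m) powr r < (S / m) powr 1" "(T / m) powr r < (T / m) powr 1"
    using assms \<open>1 < r\<close> m by (intro powr_less_mono'; simp add: m_def)+
  moreover have "S / m + T / m = 1" using m by (simp add: m_def flip: add_divide_distrib)
  ultimately have "(S / m) powr r + (T / m) powr r < 1"
    using assms m by simp
  then have "(S powr r + T powr r) / m powr r < 1"
    using assms m by (simp add: powr_divide add_divide_distrib)
  then have "S powr r + T powr r < m powr r + 0 powr r" using m by (simp add: field_simps)
  with m show ?thesis by (intro that[of m 0]) (auto simp: m_def)
qed

text \<open>Two entries with distinct nonzero absolute values can be rebalanced at constant
  \<open>q\<close>-norm so as to increase the \<open>p\<close>-norm: by equalising them if \<open>p < q\<close>, and by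
  concentrating all the mass on one of them if \<open>p > q\<close>.\<close>

lemma lp_norm_ratio_not_maximal:
  fixes x :: "'i \<Rightarrow> real"
  assumes "1 \<le> r" "1 \<le> q" "ennreal r \<noteq> q" "finite I" "a \<in> I" "b \<in> I"
    and "x a \<noteq> 0" "x b \<noteq> 0" "\<bar>x a\<bar> \<noteq> \<bar>x b\<bar>"
  shows "\<exists>x'. lp_norm q I x' = lp_norm q I x \<and> lp_norm (ennreal r) I x < lp_norm (ennreal r) I x'"
proof -
  have "a \<noteq> b" using assms by auto
  have "I \<noteq> {}" using assms by auto
  define x' where "x' s t = x(a := s, b := t)" for s t
  have sum_split: "(\<Sum>i\<in>I. \<bar>y i\<bar> powr c) = \<bar>y a\<bar> powr c + \<bar>y b\<bar> powr c + (\<Sum>i\<in>I - {a, b}. \<bar>y i\<bar> powr c)"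
    for y :: "'i \<Rightarrow> real" and c
    using assms \<open>a \<noteq> b\<close> by (subst sum.subset_diff[of "{a, b}"]) auto
  have rest: "(\<Sum>i\<in>I - {a, b}. \<bar>x' s t i\<bar> powr c) = (\<Sum>i\<in>I - {a, b}. \<bar>x i\<bar> powr c)" for s t c
    by (intro sum.cong) (auto simp: x'_def)
  have split': "(\<Sum>i\<in>I. \<bar>x' s t i\<bar> powr c)
      = \<bar>s\<bar> powr c + \<bar>t\<bar> powr c + (\<Sum>i\<in>I - {a, b}. \<bar>x i\<bar> powr c)" for s t c
    using sum_split[of "x' s t" c] rest[of s t c] \<open>a \<noteq> b\<close> by (simp add: x'_def)
  have less: "lp_norm (ennreal r) I x < lp_norm (ennreal r) I (x' s t)"
    if "\<bar>x a\<bar> powr r + \<bar>x b\<bar> powr r < \<bar>s\<bar> powr r + \<bar>t\<bar> powr r" for s t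
    using assms that unfolding lp_norm_ennreal[OF order_trans[OF zero_le_one assms(1)]]
    by (intro powr_less_mono2) (auto simp: split' sum_split[of x] intro!: add_nonneg_nonneg sum_nonneg)
  from assms(2) show ?thesis
  proof (cases rule: exponent_cases)
    case 1
    \<comment> \<open>Raising the smaller of the two entries to the larger leaves the maximum norm
      unchanged and strictly increases the power sum.\<close>
    define M where "M = max \<bar>x a\<bar> \<bar>x b\<bar>"
    have "lp_norm top I (x' M M) = lp_norm top I x"
    proof (rule order_antisym)
      have "M \<le> lp_norm top I x" "\<And>i. i \<in> I \<Longrightarrow> \<bar>x i\<bar> \<le> lp_norm top I x"
        using abs_le_lp_norm[of top I _ x] assms by (auto simp: M_def)
      then show "lp_norm top I (x' M M) \<le> lp_norm top I x"
        using assms \<open>I \<noteq> {}\<close> by (auto simp: lp_norm_infinity_le_iff x'_def M_def)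
      show "lp_norm top I x \<le> lp_norm top I (x' M M)"
        using assms \<open>I \<noteq> {}\<close> by (intro lp_norm_mono) (auto simp: x'_def M_def)
    qed
    moreover have "\<bar>x a\<bar> powr r + \<bar>x b\<bar> powr r < \<bar>M\<bar> powr r + \<bar>M\<bar> powr r"
    proof (cases "\<bar>x a\<bar> < \<bar>x b\<bar>")
      case True
      then show ?thesis using powr_less_mono2[OF _ _ True, of r] assms by (simp add: M_def)
    next
      case False
      then have "\<bar>x b\<bar> < \<bar>x a\<bar>" using assms by simp
      then show ?thesis using powr_less_mono2[OF _ _ \<open>\<bar>x b\<bar> < \<bar>x a\<bar>\<close>, of r] assms by (simp add: M_def)
    qed
    ultimately show ?thesis using 1 less[of M M] by auto
  next
    case (2 c)
    have pos: "0 < \<bar>x a\<bar> powr c" "0 < \<bar>x b\<bar> powr c" using assms by auto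
    have ne: "\<bar>x a\<bar> powr c \<noteq> \<bar>x b\<bar> powr c"
      using assms 2 powr_less_mono2[of c "\<bar>x a\<bar>" "\<bar>x b\<bar>"] powr_less_mono2[of c "\<bar>x b\<bar>" "\<bar>x a\<bar>"]
      by (cases "\<bar>x a\<bar>" "\<bar>x b\<bar>" rule: linorder_cases) auto
    have rc: "0 < r / c" "r / c \<noteq> 1" using 2 assms by auto
    \<comment> \<open>A constant \<open>q\<close>-norm fixes the sum of the two \<open>c\<close>-th
      powers, and \<open>r\<close>-th powers are their powers with exponent \<open>r / c\<close>.
      Hence the \<open>c\<close>-th powers are rebalanced, and roots are taken afterwards.\<close>
    obtain S T where ST: "0 \<le> S" "0 \<le> T" "S + T = \<bar>x a\<bar> powr c + \<bar>x b\<bar> powr c"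
      "(\<bar>x a\<bar> powr c) powr (r / c) + (\<bar>x b\<bar> powr c) powr (r / c) < S powr (r / c) + T powr (r / c)"
      by (rule powr_sum_rebalance[OF pos ne rc])
    define s where "s = S powr (1 / c)"
    define t where "t = T powr (1 / c)"
    have "(\<Sum>i\<in>I. \<bar>x' s t i\<bar> powr c) = (\<Sum>i\<in>I. \<bar>x i\<bar> powr c)"
      using ST 2 by (simp add: split' sum_split[of x] s_def t_def powr_powr)
    then have "lp_norm q I (x' s t) = lp_norm q I x" using 2 by (simp add: lp_norm_ennreal)
    moreover have "\<bar>x a\<bar> powr r + \<bar>x b\<bar> powr r < \<bar>s\<bar> powr r + \<bar>t\<bar> powr r"
      using ST(4) 2 by (simp add: s_def t_def powr_powr)
    ultimately show ?thesis using less by blast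
  qed
qed

text \<open>Rebalancing two distinct nonzero entries would beat the bound by \<open>delta\<close>.
  Zero entries are a genuine alternative: unit vectors are maximisers when
  \<open>q < ennreal r\<close>.\<close>

lemma lp_norm_delta_maximiserD:
  assumes "1 \<le> r" "1 \<le> q" "ennreal r \<noteq> q" "finite I" "a \<in> I" "b \<in> I"
    and "lp_norm (ennreal r) I x = delta (card I) (ennreal r) q * lp_norm q I x"
  shows "x a = 0 \<or> x b = 0 \<or> \<bar>x a\<bar> = \<bar>x b\<bar>"
proof (rule ccontr)
  assume "\<not> ?thesis"
  then obtain x' where "lp_norm q I x' = lp_norm q I x" "lp_norm (ennreal r) I x < lp_norm (ennreal r) I x'"
    using lp_norm_ratio_not_maximal[OF assms(1-6), of x] by auto
  moreover have "lp_norm (ennreal r) I x' \<le> delta (card I) (ennreal r) q * lp_norm q I x'"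
    using assms by (intro lp_norm_le_delta) auto
  ultimately show False using assms(7) by simp
qed

section \<open>Norm properties, continuity and compact balls for \<open>F_norm\<close>\<close>

lemma F_norm_nonneg: "0 \<le> F_norm p A"
  by (simp add: F_norm_def lp_norm_nonneg)

lemma abs_le_F_norm: "1 \<le> p \<Longrightarrow> \<bar>A $ i $ j\<bar> \<le> F_norm p A"
  using abs_le_lp_norm[of p UNIV "(i, j)" "\<lambda>(i, j). A $ i $ j"] by (simp add: F_norm_def)

lemma F_norm_scaleR: "1 \<le> p \<Longrightarrow> F_norm p (c *\<^sub>R A) = \<bar>c\<bar> * F_norm p A"
  using lp_norm_scale[of p UNIV c "\<lambda>(i, j). A $ i $ j"]
  by (simp add: F_norm_def case_prod_unfold)

lemma F_norm_triangle: "1 \<le> p \<Longrightarrow> F_norm p (A + B) \<le> F_norm p A + F_norm p B"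
  using lp_norm_triangle[of p UNIV "\<lambda>(i, j). A $ i $ j" "\<lambda>(i, j). B $ i $ j"]
  by (simp add: F_norm_def case_prod_unfold)

lemma F_norm_eq_0_iff: "1 \<le> p \<Longrightarrow> F_norm p A = 0 \<longleftrightarrow> A = 0"
  by (simp add: F_norm_def lp_norm_eq_0_iff vec_eq_iff)

lemma F_norm_le_delta:
  fixes A :: "real^'n^'m"
  assumes "1 \<le> a" "1 \<le> b"
  shows "F_norm a A \<le> delta (CARD('m) * CARD('n)) a b * F_norm b A"
  using lp_norm_le_delta[OF _ _ assms, of "UNIV :: ('m \<times> 'n) set"] by (simp add: F_norm_def)

lemma continuous_on_F_norm:
  assumes "1 \<le> p"
  shows "continuous_on S (F_norm p :: real^'n^'m \<Rightarrow> real)"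
proof -
  have "continuous_on S (\<lambda>A :: real^'n^'m. \<lambda>(i, j). A $ i $ j)"
    by (intro continuous_on_coordinatewise_then_product)
      (auto simp: case_prod_unfold intro!: continuous_intros)
  then have "continuous_on S (\<lambda>A :: real^'n^'m. lp_norm p UNIV (\<lambda>(i, j). A $ i $ j))"
    by (rule continuous_on_compose2[OF continuous_on_lp_norm[OF assms finite UNIV_not_empty]]) auto
  then show ?thesis by (simp add: F_norm_def[abs_def])
qed

lemma compact_F_norm_cball:
  assumes "1 \<le> q"
  shows "compact {Y :: real^'n^'m. F_norm q Y \<le> R}"
proof -
  have "bounded {Y :: real^'n^'m. F_norm q Y \<le> R}"
    unfolding bounded_iff
  proof (intro exI ballI)
    fix Y :: "real^'n^'m" assume Y: "Y \<in> {Y. F_norm q Y \<le> R}"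
    have "norm Y \<le> (\<Sum>i\<in>UNIV. norm (Y $ i))" unfolding norm_vec_def by (intro L2_set_le_sum) auto
    also have "\<dots> \<le> (\<Sum>i\<in>(UNIV :: 'm set). \<Sum>j\<in>(UNIV :: 'n set). \<bar>Y $ i $ j\<bar>)"
      by (intro sum_mono norm_le_l1_cart)
    also have "\<dots> \<le> (\<Sum>i\<in>(UNIV :: 'm set). \<Sum>j\<in>(UNIV :: 'n set). R)"
      using Y order_trans[OF abs_le_F_norm[OF assms]] by (intro sum_mono) auto
    finally show "norm Y \<le> (\<Sum>i\<in>(UNIV :: 'm set). \<Sum>j\<in>(UNIV :: 'n set). R)" .
  qed
  moreover have "closed {Y :: real^'n^'m. F_norm q Y \<le> R}"
    using continuous_on_F_norm[OF assms] by (intro closed_Collect_le) auto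
  ultimately show ?thesis by (simp add: compact_eq_bounded_closed)
qed

section \<open>The set of perturbations \<open>D X\<close> for \<open>D\<close> in the uncertainty
  set\<close>

lemma matrix_eq_sum_units:
  fixes X :: "real^'n^'m"
  shows "X = (\<Sum>c\<in>UNIV. X $ fst c $ snd c *\<^sub>R axis (fst c) (axis (snd c) 1))"
proof -
  have "(\<Sum>c\<in>UNIV. X $ fst c $ snd c * (axis (fst c) (axis (snd c) 1) :: real^'n^'m) $ i $ j) = X $ i $ j" for i j
  proof -
    have "(\<Sum>c\<in>UNIV. X $ fst c $ snd c * (axis (fst c) (axis (snd c) 1) :: real^'n^'m) $ i $ j)
        = (\<Sum>c\<in>UNIV. if c = (i, j) then X $ i $ j else 0)"
      by (intro sum.cong) (auto simp: axis_def)
    then show ?thesis by simp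
  qed
  then show ?thesis by (simp add: vec_eq_iff)
qed

lemma linear_basis_matrix:
  assumes "linear D"
  shows "D X $ i $ j = (\<Sum>c\<in>UNIV. basis_matrix D $ (i, j) $ c * X $ fst c $ snd c)"
proof -
  have "D X = (\<Sum>c\<in>UNIV. X $ fst c $ snd c *\<^sub>R D (axis (fst c) (axis (snd c) 1)))"
    using assms by (subst matrix_eq_sum_units) (simp add: linear_sum linear_scale)
  then show ?thesis by (simp add: basis_matrix_def mult.commute)
qed

lemma F_norm_basis_matrix:
  assumes "1 \<le> q"
  shows "F_norm q (basis_matrix D) = lp_norm q UNIV (\<lambda>r. lp_norm q UNIV (\<lambda>c. basis_matrix D $ r $ c))"
  using lp_norm_Times[OF assms, of UNIV UNIV "\<lambda>r c. basis_matrix D $ r $ c"]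
  by (simp add: F_norm_def)

text \<open>Hoelder's inequality in row \<open>(i, j)\<close> of the basis matrix bounds that entry
  of \<open>D X\<close> by the row norm times the conjugate norm of \<open>X\<close>; the row norms
  recombine to the norm of the whole matrix.\<close>

lemma F_norm_linear_le:
  fixes X :: "real^'n^'m"
  assumes "linear D" "1 \<le> q"
  shows "F_norm q (D X) \<le> F_norm q (basis_matrix D) * F_norm (conj_exponent q) X"
proof -
  define N where "N = F_norm (conj_exponent q) X"
  have "0 \<le> N" by (simp add: N_def F_norm_nonneg)
  define M where "M = (\<lambda>r. lp_norm q UNIV (\<lambda>c. basis_matrix D $ r $ c))"
  have M: "0 \<le> M r" for r by (simp add: M_def lp_norm_nonneg)
  have "\<bar>D X $ i $ j\<bar> \<le> N * M (i, j)" for i j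
    using Holder_sum[OF assms(2), of UNIV "\<lambda>c. basis_matrix D $ (i, j) $ c" "\<lambda>(i, j). X $ i $ j"]
    by (simp add: linear_basis_matrix[OF assms(1)] M_def N_def F_norm_def case_prod_unfold mult.commute)
  then have "F_norm q (D X) \<le> lp_norm q UNIV (\<lambda>r. N * M r)"
    unfolding F_norm_def using assms(2) M \<open>0 \<le> N\<close> by (intro lp_norm_mono) (auto simp: abs_mult)
  also have "\<dots> = N * F_norm q (basis_matrix D)"
    using assms(2) \<open>0 \<le> N\<close> by (simp add: lp_norm_scale F_norm_basis_matrix M_def)
  finally show ?thesis by (simp add: N_def mult.commute)
qed

text \<open>This replaces linear maps by a norm ball. One inclusion is Hoelder's inequality; for the
  other, a map of rank at most one reaches \<open>Y\<close>: it pairs its argument with a vector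
  \<open>v\<close> extremal for \<open>X\<close> and multiplies \<open>Y\<close> by the normalised
  result.\<close>

lemma image_uncertainty_set:
  fixes X :: "real^'n^'m"
  assumes "1 \<le> q" "0 \<le> l"
  shows "(\<lambda>D. D X) ` uncertainty_set q l = {Y. F_norm q Y \<le> l * F_norm (conj_exponent q) X}"
proof (intro equalityI subsetI)
  fix Y assume "Y \<in> (\<lambda>D. D X) ` uncertainty_set q l"
  then obtain D where D: "Y = D X" "linear D" "F_norm q (basis_matrix D) \<le> l"
    by (auto simp: uncertainty_set_def)
  have "F_norm q Y \<le> F_norm q (basis_matrix D) * F_norm (conj_exponent q) X"
    unfolding D(1) by (rule F_norm_linear_le[OF D(2) assms(1)])
  also have "\<dots> \<le> l * F_norm (conj_exponent q) X"
    using D(3) by (intro mult_right_mono) (auto simp: F_norm_nonneg)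
  finally show "Y \<in> {Y. F_norm q Y \<le> l * F_norm (conj_exponent q) X}" by simp
next
  fix Y :: "real^'n^'m" assume "Y \<in> {Y. F_norm q Y \<le> l * F_norm (conj_exponent q) X}"
  then have Y: "F_norm q Y \<le> l * F_norm (conj_exponent q) X" by simp
  define N where "N = F_norm (conj_exponent q) X"
  have "0 \<le> N" by (simp add: N_def F_norm_nonneg)
  obtain v :: "'m \<times> 'n \<Rightarrow> real"
    where v: "lp_norm q UNIV v \<le> 1" "(\<Sum>c\<in>UNIV. v c * X $ fst c $ snd c) = N"
    using lp_norm_dual_attained[OF assms(1), of UNIV "\<lambda>(i, j). X $ i $ j"]
    by (auto simp: N_def F_norm_def case_prod_unfold)
  \<comment> \<open>If \<open>N = 0\<close>, then \<open>1 / N = 0\<close> and \<open>D = 0\<close>.\<close>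
  define D :: "real^'n^'m \<Rightarrow> real^'n^'m"
    where "D = (\<lambda>W. (1 / N * (\<Sum>c\<in>UNIV. v c * W $ fst c $ snd c)) *\<^sub>R Y)"
  have "linear D"
    unfolding D_def by (rule linearI)
      (auto simp: sum.distrib scaleR_add_left distrib_left sum_distrib_left mult_ac intro!: sum.cong arg_cong2[where f = "(*\<^sub>R)"])
  have "(\<Sum>d\<in>UNIV. v d * (axis (fst c) (axis (snd c) 1) :: real^'n^'m) $ fst d $ snd d) = v c" for c
  proof -
    have "(\<Sum>d\<in>UNIV. v d * (axis (fst c) (axis (snd c) 1) :: real^'n^'m) $ fst d $ snd d)
        = (\<Sum>d\<in>UNIV. if d = c then v c else 0)"
      by (intro sum.cong) (auto simp: axis_def prod_eq_iff)
    then show ?thesis by simp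
  qed
  \<comment> \<open>The matrix of \<open>D\<close> is the outer product of \<open>Y\<close> and
    \<open>v\<close> divided by \<open>N\<close>, so its norm is the product of the two norms
    divided by \<open>N\<close>.\<close>
  then have "lp_norm q UNIV (\<lambda>c. basis_matrix D $ r $ c)
      = lp_norm q UNIV (\<lambda>c. (1 / N * Y $ fst r $ snd r) * v c)" for r
    by (simp add: basis_matrix_def D_def mult.commute)
  also have "\<dots> r = lp_norm q UNIV v * (1 / N * \<bar>Y $ fst r $ snd r\<bar>)" for r
    using assms(1) \<open>0 \<le> N\<close>
    by (simp only: lp_norm_scale finite UNIV_not_empty not_False_eq_True) (simp add: abs_mult)
  finally have "F_norm q (basis_matrix D)
      = lp_norm q UNIV (\<lambda>r. lp_norm q UNIV v * (1 / N * \<bar>Y $ fst r $ snd r\<bar>))"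
    by (simp add: F_norm_basis_matrix[OF assms(1)])
  also have "\<dots> = lp_norm q UNIV v * (1 / N * F_norm q Y)"
    using assms(1) \<open>0 \<le> N\<close>
    by (simp only: lp_norm_scale finite UNIV_not_empty not_False_eq_True lp_norm_abs F_norm_def
        case_prod_unfold) (simp add: lp_norm_nonneg)
  also have "\<dots> \<le> 1 * (1 / N * F_norm q Y)"
    using v \<open>0 \<le> N\<close> by (intro mult_right_mono) (auto simp: F_norm_nonneg)
  also have "\<dots> \<le> l"
    using Y \<open>0 \<le> N\<close> assms(2) by (cases "N = 0") (auto simp: N_def field_simps)
  finally have "D \<in> uncertainty_set q l" using \<open>linear D\<close> by (simp add: uncertainty_set_def)
  moreover have "D X = Y"
  proof (cases "N = 0")
    case True
    then have "Y = 0" using Y F_norm_nonneg[of q Y] F_norm_eq_0_iff[OF assms(1), of Y]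
      by (simp add: N_def)
    then show ?thesis by (simp add: D_def)
  next
    case False
    then show ?thesis using v by (simp add: D_def)
  qed
  ultimately show "Y \<in> (\<lambda>D. D X) ` uncertainty_set q l" by blast
qed

section \<open>Attainment of the worst case and the two bounds\<close>

text \<open>Over the image ball the supremum is that of a continuous function on a nonempty compact
  set.\<close>

lemma worst_case_attained:
  fixes X Z :: "real^'n^'m"
  assumes "1 \<le> p" "1 \<le> q" "0 \<le> l"
  defines "R \<equiv> l * F_norm (conj_exponent q) X"
  shows "\<exists>Y. F_norm q Y \<le> R \<and> F_norm p (Z + Y) = worst_case p q l Z X"
    and "\<And>Y. F_norm q Y \<le> R \<Longrightarrow> F_norm p (Z + Y) \<le> worst_case p q l Z X"
proof -
  let ?B = "{Y :: real^'n^'m. F_norm q Y \<le> R}"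
  have "0 \<le> R" using assms(3) by (simp add: R_def F_norm_nonneg)
  then have "0 \<in> ?B" using F_norm_eq_0_iff[OF assms(2), of "0 :: real^'n^'m"] by simp
  moreover have "continuous_on ?B (\<lambda>Y. F_norm p (Z + Y))"
    by (rule continuous_on_compose2[OF continuous_on_F_norm[OF assms(1), of UNIV]])
      (auto intro!: continuous_intros)
  ultimately obtain Y where Y: "Y \<in> ?B" "\<And>W. W \<in> ?B \<Longrightarrow> F_norm p (Z + W) \<le> F_norm p (Z + Y)"
    using continuous_attains_sup[OF compact_F_norm_cball[OF assms(2), of R]] by blast
  have "worst_case p q l Z X = (SUP W \<in> (\<lambda>D. D X) ` uncertainty_set q l. F_norm p (Z + W))"
    by (simp add: worst_case_def image_image)
  also have "\<dots> = (SUP W \<in> ?B. F_norm p (Z + W))"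
    by (simp add: image_uncertainty_set[OF assms(2,3)] R_def)
  also have "\<dots> = F_norm p (Z + Y)"
    using Y by (intro cSup_eq_maximum) auto
  finally have eq: "worst_case p q l Z X = F_norm p (Z + Y)" .
  show "\<exists>Y. F_norm q Y \<le> R \<and> F_norm p (Z + Y) = worst_case p q l Z X"
    using Y(1) eq by auto
  show "F_norm p (Z + W) \<le> worst_case p q l Z X" if "F_norm q W \<le> R" for W
    using Y(2) eq that by simp
qed

lemma worst_case_le:
  fixes X Z :: "real^'n^'m"
  assumes "1 \<le> p" "1 \<le> q" "0 \<le> l"
    and "\<And>Y. F_norm q Y \<le> l * F_norm (conj_exponent q) X \<Longrightarrow> F_norm p (Z + Y) \<le> c"
  shows "worst_case p q l Z X \<le> c"
  using worst_case_attained(1)[OF assms(1-3), of X Z] assms(4) by metis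

text \<open>A perturbation of \<open>q\<close>-norm \<open>R\<close> in the direction of
  \<open>Z\<close> makes the \<open>p\<close>-norms add up, and its \<open>p\<close>-norm is at
  least \<open>R\<close> divided by \<open>delta\<close>.\<close>

lemma worst_case_lower_bound:
  fixes X Z :: "real^'n^'m"
  assumes "1 \<le> p" "1 \<le> q" "0 \<le> l"
  shows "F_norm p Z + l / delta (CARD('m) * CARD('n)) q p * F_norm (conj_exponent q) X
    \<le> worst_case p q l Z X"
proof -
  define R where "R = l * F_norm (conj_exponent q) X"
  have "0 \<le> R" using assms(3) by (simp add: R_def F_norm_nonneg)
  define d where "d = delta (CARD('m) * CARD('n)) q p"
  have d: "0 < d" unfolding d_def using assms by (intro delta_pos) (auto simp: Suc_le_eq)
  \<comment> \<open>\<open>Z = 0\<close> has no direction of its own; the all-ones matrix with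
    \<open>s = 0\<close> then serves.\<close>
  obtain U :: "real^'n^'m" and s where U: "U \<noteq> 0" "0 \<le> s" "Z = s *\<^sub>R U"
  proof (cases "Z = 0")
    case True
    have "(1 :: real^'n^'m) \<noteq> 0" by simp
    then show ?thesis using that[of 1 0] True by simp
  next
    case False
    then show ?thesis using that[of Z 1] by simp
  qed
  have "0 < F_norm q U" using U F_norm_eq_0_iff[OF assms(2), of U] F_norm_nonneg[of q U] by simp
  define Y where "Y = (R / F_norm q U) *\<^sub>R U"
  have Y: "F_norm q Y = R"
    using \<open>0 < F_norm q U\<close> \<open>0 \<le> R\<close> assms by (simp add: Y_def F_norm_scaleR)
  have "Z + Y = (s + R / F_norm q U) *\<^sub>R U" by (simp add: U Y_def scaleR_add_left)
  then have "F_norm p (Z + Y) = F_norm p Z + F_norm p Y"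
    using \<open>0 < F_norm q U\<close> \<open>0 \<le> R\<close> assms U by (simp add: Y_def F_norm_scaleR distrib_right)
  moreover have "R \<le> d * F_norm p Y" using F_norm_le_delta[OF assms(2,1), of Y] by (simp add: Y d_def)
  then have "R / d \<le> F_norm p Y" using d by (simp add: field_simps)
  moreover have "F_norm p (Z + Y) \<le> worst_case p q l Z X"
    using worst_case_attained(2)[OF assms, of Y X Z] Y by (simp add: R_def)
  ultimately show ?thesis by (simp add: R_def d_def)
qed

lemma F_norm_add_le:
  fixes Z Y :: "real^'n^'m"
  assumes "1 \<le> p" "1 \<le> q" "F_norm q Y \<le> R"
  shows "F_norm p (Z + Y) \<le> F_norm p Z + delta (CARD('m) * CARD('n)) p q * R"
proof -
  have "0 < delta (CARD('m) * CARD('n)) p q" using assms by (intro delta_pos) (auto simp: Suc_le_eq)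
  then have "delta (CARD('m) * CARD('n)) p q * F_norm q Y \<le> delta (CARD('m) * CARD('n)) p q * R"
    using assms(3) by simp
  then show ?thesis using F_norm_triangle[OF assms(1), of Z Y] F_norm_le_delta[OF assms(1,2), of Y]
    by linarith
qed

text \<open>Equality forces equality both in the triangle inequality and in the comparison of the
  two norms of \<open>Y\<close>. The first makes the absolute values of \<open>Z\<close> and
  \<open>Y\<close> proportional, the second makes \<open>Y\<close> a maximiser, and the restriction
  on two entries of \<open>Y\<close> passes to \<open>Z\<close>.\<close>

lemma F_norm_add_eqD:
  fixes Z Y :: "real^'n^'m"
  assumes "1 < r" "1 \<le> q" "ennreal r \<noteq> q" "F_norm q Y \<le> R" "0 < R"
    and eq: "F_norm (ennreal r) (Z + Y) = F_norm (ennreal r) Z + delta (CARD('m) * CARD('n)) (ennreal r) q * R"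
  shows "Z $ fst a $ snd a = 0 \<or> Z $ fst b $ snd b = 0 \<or> \<bar>Z $ fst a $ snd a\<bar> = \<bar>Z $ fst b $ snd b\<bar>"
proof (cases "Z = 0")
  case False
  define d where "d = delta (CARD('m) * CARD('n)) (ennreal r) q"
  define A where "A = F_norm (ennreal r) Z"
  define B where "B = F_norm (ennreal r) Y"
  have r: "1 \<le> ennreal r" using assms by simp
  have d: "0 < d" unfolding d_def using assms by (intro delta_pos) (auto simp: Suc_le_eq)
  have "0 < A" using False F_norm_eq_0_iff[OF r, of Z] F_norm_nonneg[of "ennreal r" Z] by (simp add: A_def)
  have le: "B \<le> d * F_norm q Y" using F_norm_le_delta[OF r assms(2), of Y] by (simp add: B_def d_def)
  have le': "d * F_norm q Y \<le> d * R" using assms d by simp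
  have le'': "A + d * R \<le> A + B" using F_norm_triangle[OF r, of Z Y] eq by (simp add: A_def B_def d_def)
  \<comment> \<open>The chain \<open>B \<le> d * F_norm q Y \<le> d * R \<le> B\<close>
    collapses.\<close>
  have B: "B = d * F_norm q Y" "B = d * R" using le le' le'' by auto
  then have "0 < B" using d assms by simp
  have "F_norm (ennreal r) (Z + Y) = A + B" using eq B(2) by (simp add: A_def d_def)
  then have "\<bar>Z $ fst c $ snd c\<bar> / A = \<bar>Y $ fst c $ snd c\<bar> / B" for c
    using lp_norm_triangle_eqD[OF assms(1) finite UNIV_I,
        of "\<lambda>(i, j). Z $ i $ j" "\<lambda>(i, j). Y $ i $ j" c] \<open>0 < A\<close> \<open>0 < B\<close>
    unfolding A_def B_def F_norm_def by (simp add: case_prod_unfold)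
  moreover have "Y $ fst a $ snd a = 0 \<or> Y $ fst b $ snd b = 0 \<or> \<bar>Y $ fst a $ snd a\<bar> = \<bar>Y $ fst b $ snd b\<bar>"
    using lp_norm_delta_maximiserD[of r q UNIV a b "\<lambda>(i, j). Y $ i $ j"] assms B(1)
    by (simp add: B_def d_def F_norm_def case_prod_unfold)
  ultimately show ?thesis using \<open>0 < A\<close> \<open>0 < B\<close>
    by (metis abs_eq_0_iff divide_eq_0_iff less_irrefl divide_cancel_right)
qed simp

section \<open>Strictness of the upper bound for almost all \<open>Z\<close>\<close>

text \<open>With two distinct positions \<open>a\<close> and \<open>b\<close>, equality at the
  attaining perturbation confines \<open>Z\<close> to finitely many hyperplanes, a null set.\<close>

lemma worst_case_less_AE:
  fixes X :: "real^'n^'m"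
  assumes "1 < r" "1 \<le> q" "ennreal r \<noteq> q" "0 < l" "X \<noteq> 0" "2 \<le> CARD('m) * CARD('n)"
  shows "AE Z in lebesgue. worst_case (ennreal r) q l Z X
    < F_norm (ennreal r) Z
      + l * delta (CARD('m) * CARD('n)) (ennreal r) q * F_norm (conj_exponent q) X"
proof -
  define R where "R = l * F_norm (conj_exponent q) X"
  have "0 < R"
    using assms F_norm_eq_0_iff[OF conj_exponent_ge_1[OF assms(2)], of X] F_norm_nonneg[of "conj_exponent q" X]
    by (simp add: R_def)
  have r: "1 \<le> ennreal r" using assms by simp
  have "\<not> card (UNIV :: ('m \<times> 'n) set) \<le> 1" using assms(6) by simp
  then obtain a b :: "'m \<times> 'n" where "a \<noteq> b"
    by (metis UNIV_I card_le_Suc0_iff_eq finite_class.finite_UNIV One_nat_def)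
  define e :: "'m \<times> 'n \<Rightarrow> real^'n^'m" where "e = (\<lambda>c. axis (fst c) (axis (snd c) 1))"
  have e: "e c \<bullet> Z = Z $ fst c $ snd c" for c Z
    by (simp add: e_def inner_axis inner_commute[of "axis _ _"])
  have "e a $ fst a $ snd a = 1" "e b $ fst b $ snd b = 1" "e b $ fst a $ snd a = 0"
    using \<open>a \<noteq> b\<close> by (auto simp: e_def axis_def prod_eq_iff)
  \<comment> \<open>One nonzero entry each shows that the four normal vectors are nonzero, so that
    the sets below are proper hyperplanes.\<close>
  then have "(e a - e b) $ fst a $ snd a \<noteq> 0" "(e a + e b) $ fst a $ snd a \<noteq> 0"
    "e a $ fst a $ snd a \<noteq> 0" "e b $ fst b $ snd b \<noteq> 0" by auto
  then have ne: "e a \<noteq> 0" "e b \<noteq> 0" "e a - e b \<noteq> 0" "e a + e b \<noteq> 0"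
    by (metis zero_index)+
  define H where "H = {Z. e a \<bullet> Z = 0} \<union> {Z. e b \<bullet> Z = 0} \<union> {Z. (e a - e b) \<bullet> Z = 0} \<union> {Z. (e a + e b) \<bullet> Z = 0}"
  have "negligible H"
    unfolding H_def using ne by (intro negligible_Un negligible_hyperplane) auto
  then have "AE Z in lebesgue. Z \<notin> H" by (intro AE_not_in) (simp add: negligible_iff_null_sets)
  then show ?thesis
  proof (rule AE_mp, intro AE_I2 impI)
    fix Z assume "Z \<notin> H"
    then have Z: "Z $ fst a $ snd a \<noteq> 0" "Z $ fst b $ snd b \<noteq> 0" "\<bar>Z $ fst a $ snd a\<bar> \<noteq> \<bar>Z $ fst b $ snd b\<bar>"
      by (auto simp: H_def e inner_diff_left inner_add_left abs_eq_iff)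
    obtain Y where Y: "F_norm q Y \<le> R" "F_norm (ennreal r) (Z + Y) = worst_case (ennreal r) q l Z X"
      using worst_case_attained(1)[OF r assms(2), of l X Z] assms(4) by (auto simp: R_def)
    have "F_norm (ennreal r) (Z + Y) \<noteq> F_norm (ennreal r) Z + delta (CARD('m) * CARD('n)) (ennreal r) q * R"
      using F_norm_add_eqD[OF assms(1-3) Y(1) \<open>0 < R\<close>, of Z a b] Z by blast
    moreover have "F_norm (ennreal r) (Z + Y) \<le> F_norm (ennreal r) Z + delta (CARD('m) * CARD('n)) (ennreal r) q * R"
      using F_norm_add_le[OF r assms(2) Y(1)] .
    ultimately show "worst_case (ennreal r) q l Z X < F_norm (ennreal r) Z
        + l * delta (CARD('m) * CARD('n)) (ennreal r) q * F_norm (conj_exponent q) X"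
      using Y(2) by (simp add: R_def mult_ac)
  qed
qed

section \<open>The infimum of the gap in the lower bound\<close>

lemma INF_eq_0_if_tendsto_0:
  fixes f :: "'a \<Rightarrow> real" and g :: "real \<Rightarrow> 'a"
  assumes "\<And>z. 0 \<le> f z" "(h \<longlongrightarrow> 0) at_top" "\<forall>\<^sub>F t in at_top. f (g t) \<le> h t"
  shows "(INF z. f z) = 0"
proof (rule order_antisym)
  have "bdd_below (range f)" using assms(1) by (intro bdd_belowI[of _ 0]) auto
  then have "\<forall>\<^sub>F t in at_top. (INF z. f z) \<le> h t"
    using assms(3) by (auto elim!: eventually_mono intro: cINF_lower order_trans)
  then show "(INF z. f z) \<le> 0" by (intro tendsto_lowerbound[OF assms(2)]) auto
  show "0 \<le> (INF z. f z)" using assms(1) by (intro cINF_greatest) auto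
qed

lemma powr_inverse_le_tangent:
  fixes x r :: real
  assumes "1 \<le> r" "0 \<le> x"
  shows "(1 + x) powr (1 / r) \<le> 1 + x / r"
proof (cases "r = 1 \<or> x = 0")
  case False
  then show ?thesis using powr_less_tangent[of "1 / r" "1 + x"] assms by simp
qed (use assms in auto)

text \<open>The tangent to the power at \<open>t + a\<close>, evaluated at \<open>t\<close>, lies
  below the graph.\<close>

lemma powr_add_le_tangent:
  fixes t a r :: real
  assumes "1 \<le> r" "0 < t" "0 \<le> a"
  shows "(t + a) powr r \<le> t powr r + r * a * (t + a) powr (r - 1)"
proof -
  have "(t + a) powr r * (1 + r * (t / (t + a) - 1)) \<le> (t + a) powr r * (t / (t + a)) powr r"
    using assms by (intro mult_left_mono powr_ge_tangent) auto
  also have "\<dots> = t powr r" using assms by (simp add: powr_divide)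
  also have "(t + a) powr r * (1 + r * (t / (t + a) - 1))
      = (t + a) powr r - r * a * ((t + a) powr r / (t + a))"
    using assms by (simp add: field_simps)
  also have "(t + a) powr r / (t + a) = (t + a) powr (r - 1)"
    using assms by (simp add: powr_diff)
  finally show ?thesis by simp
qed

lemma F_norm_ennreal:
  "0 \<le> r \<Longrightarrow> F_norm (ennreal r) A = (\<Sum>c\<in>UNIV. \<bar>A $ fst c $ snd c\<bar> powr r) powr (1 / r)"
  by (simp add: F_norm_def lp_norm_ennreal case_prod_unfold)

text \<open>Serves the case \<open>p < q\<close>. A perturbation raises the large entry to at most
  \<open>t + R\<close>, while every other entry stays within \<open>R\<close>. Their contribution to
  the power sum is bounded, so after the \<open>r\<close>-th root it decays like
  \<open>(t + R) powr (1 - r)\<close>.\<close>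

lemma worst_case_matrix_unit:
  fixes X :: "real^'n^'m" and i :: 'm and j :: 'n
  assumes "1 < r" "1 \<le> q" "0 \<le> l" "0 < t"
  defines "k \<equiv> real (CARD('m) * CARD('n))" and "R \<equiv> l * F_norm (conj_exponent q) X"
    and "E \<equiv> axis i (axis j 1) :: real^'n^'m"
  shows "F_norm (ennreal r) (t *\<^sub>R E) = t"
    and "worst_case (ennreal r) q l (t *\<^sub>R E) X \<le> t + R + k * R powr r * (t + R) powr (1 - r)"
proof -
  have E: "E $ fst c $ snd c = (if c = (i, j) then 1 else 0)" for c
    by (cases c) (auto simp: E_def axis_def)
  have "(\<Sum>c\<in>UNIV. \<bar>(t *\<^sub>R E) $ fst c $ snd c\<bar> powr r) = (\<Sum>c\<in>UNIV. if c = (i, j) then t powr r else 0)"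
    using assms(1-4) by (intro sum.cong) (auto simp: E)
  then show "F_norm (ennreal r) (t *\<^sub>R E) = t"
    using assms by (simp add: F_norm_ennreal powr_powr)
  have "0 \<le> R" using assms by (simp add: R_def F_norm_nonneg)
  have "0 \<le> k" by (simp add: k_def)
  have r: "1 \<le> ennreal r" using assms by simp
  show "worst_case (ennreal r) q l (t *\<^sub>R E) X \<le> t + R + k * R powr r * (t + R) powr (1 - r)"
  proof (rule worst_case_le[OF r assms(2,3)])
    fix Y :: "real^'n^'m" assume "F_norm q Y \<le> l * F_norm (conj_exponent q) X"
    then have Y: "\<bar>Y $ a $ b\<bar> \<le> R" for a b
      using abs_le_F_norm[OF assms(2), of Y] order_trans by (fastforce simp: R_def)
    \<comment> \<open>\<open>u\<close> bounds the contribution of the small entries relative to the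
      large one; allowing \<open>R powr r\<close> at all \<open>k\<close> positions keeps the
      formula simple.\<close>
    define u where "u = k * R powr r / (t + R) powr r"
    have "0 \<le> u" using \<open>0 \<le> k\<close> by (simp add: u_def)
    then have ur: "u / r \<le> u" using assms(1) mult_right_mono[of 1 r u] by (simp add: field_simps)
    have "(\<Sum>c\<in>UNIV. \<bar>(t *\<^sub>R E + Y) $ fst c $ snd c\<bar> powr r)
        \<le> (\<Sum>c\<in>(UNIV :: ('m \<times> 'n) set). (if c = (i, j) then (t + R) powr r else 0) + R powr r)"
    proof (rule sum_mono)
      fix c :: "'m \<times> 'n"
      have "\<bar>(t *\<^sub>R E + Y) $ fst c $ snd c\<bar> \<le> (if c = (i, j) then t + R else R)"
        using Y[of "fst c" "snd c"] assms(1-4) by (auto simp: E)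
      then have "\<bar>(t *\<^sub>R E + Y) $ fst c $ snd c\<bar> powr r \<le> (if c = (i, j) then t + R else R) powr r"
        using assms by (intro powr_mono2) auto
      then show "\<bar>(t *\<^sub>R E + Y) $ fst c $ snd c\<bar> powr r \<le> (if c = (i, j) then (t + R) powr r else 0) + R powr r"
        by (auto split: if_splits intro: order_trans)
    qed
    also have "\<dots> = (t + R) powr r + k * R powr r" by (simp add: sum.distrib k_def)
    also have "\<dots> = (t + R) powr r * (1 + u)"
      using assms \<open>0 \<le> R\<close> by (simp add: u_def field_simps)
    finally have "F_norm (ennreal r) (t *\<^sub>R E + Y) \<le> ((t + R) powr r * (1 + u)) powr (1 / r)"
      using assms by (auto simp: F_norm_ennreal intro!: powr_mono2 sum_nonneg)
    also have "\<dots> = (t + R) * (1 + u) powr (1 / r)"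
      using assms \<open>0 \<le> u\<close> \<open>0 \<le> R\<close> by (simp add: powr_mult powr_powr)
    also have "\<dots> \<le> (t + R) * (1 + u / r)"
      using assms \<open>0 \<le> u\<close> \<open>0 \<le> R\<close> by (intro mult_left_mono powr_inverse_le_tangent) auto
    also have "\<dots> \<le> (t + R) * (1 + u)"
      using assms(4) \<open>0 \<le> R\<close> ur by (intro mult_left_mono) auto
    also have "\<dots> = t + R + k * R powr r * ((t + R) / (t + R) powr r)"
      by (simp add: u_def algebra_simps)
    also have "(t + R) / (t + R) powr r = (t + R) powr (1 - r)"
      using assms \<open>0 \<le> R\<close> by (simp add: powr_diff)
    finally show "F_norm (ennreal r) (t *\<^sub>R E + Y) \<le> t + R + k * R powr r * (t + R) powr (1 - r)" .
  qed
qed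

text \<open>Serves the case \<open>p > q\<close>. To first order only the sum of the absolute
  entries of \<open>Y\<close> matters, and the power mean inequality bounds it by
  \<open>k powr (1 - 1 / c) * R\<close>. The remaining factor
  \<open>((t + R) / t) powr (r - 1)\<close> tends to 1 as \<open>t\<close> grows.\<close>

lemma worst_case_all_ones:
  fixes X :: "real^'n^'m"
  assumes "1 < r" "1 \<le> c" "0 \<le> l" "0 < t"
  defines "k \<equiv> real (CARD('m) * CARD('n))" and "R \<equiv> l * F_norm (conj_exponent (ennreal c)) X"
    and "J \<equiv> (\<chi> i j. 1) :: real^'n^'m"
  shows "F_norm (ennreal r) (t *\<^sub>R J) = k powr (1 / r) * t"
    and "worst_case (ennreal r) (ennreal c) l (t *\<^sub>R J) X
      \<le> k powr (1 / r) * t + k powr (1 / r - 1 / c) * R * ((t + R) / t) powr (r - 1)"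
proof -
  have k: "0 < k" by (simp add: k_def)
  show "F_norm (ennreal r) (t *\<^sub>R J) = k powr (1 / r) * t"
    using assms k by (simp add: F_norm_ennreal J_def powr_mult powr_powr)
  have "0 \<le> R" using assms by (simp add: R_def F_norm_nonneg)
  have r: "1 \<le> ennreal r" and c: "1 \<le> ennreal c" using assms by simp_all
  show "worst_case (ennreal r) (ennreal c) l (t *\<^sub>R J) X
      \<le> k powr (1 / r) * t + k powr (1 / r - 1 / c) * R * ((t + R) / t) powr (r - 1)"
  proof (rule worst_case_le[OF r c assms(3)])
    fix Y :: "real^'n^'m" assume "F_norm (ennreal c) Y \<le> l * F_norm (conj_exponent (ennreal c)) X"
    then have YR: "F_norm (ennreal c) Y \<le> R" by (simp add: R_def)
    have Y: "\<bar>Y $ a $ b\<bar> \<le> R" for a b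
      using abs_le_F_norm[OF c, of Y] YR order_trans by fastforce
    have "(\<Sum>a\<in>UNIV. \<bar>Y $ fst a $ snd a\<bar>) = lp_norm (ennreal 1) UNIV (\<lambda>(i, j). Y $ i $ j)"
      by (simp add: lp_norm_one case_prod_unfold)
    also have "\<dots> \<le> k powr (1 / 1 - 1 / c) * F_norm (ennreal c) Y"
      using power_mean_lp_norm[of 1 c "UNIV :: ('m \<times> 'n) set" "\<lambda>(i, j). Y $ i $ j"] assms
      by (simp add: k_def F_norm_def)
    also have "\<dots> \<le> k powr (1 - 1 / c) * R" using YR by (simp add: mult_left_mono)
    finally have S: "(\<Sum>a\<in>UNIV. \<bar>Y $ fst a $ snd a\<bar>) \<le> k powr (1 - 1 / c) * R" .
    \<comment> \<open>Chosen so that the power sum is at most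
      \<open>k * t powr r * (1 + r * u)\<close>; the tangent bound for the \<open>r\<close>-th root
      then cancels the factor \<open>r\<close>.\<close>
    define u where "u = (t + R) powr (r - 1) * (k powr (1 - 1 / c) * R) / (k * t powr r)"
    have "0 \<le> u" using k \<open>0 \<le> R\<close> by (simp add: u_def)
    have "(\<Sum>a\<in>UNIV. \<bar>(t *\<^sub>R J + Y) $ fst a $ snd a\<bar> powr r)
        \<le> (\<Sum>a\<in>(UNIV :: ('m \<times> 'n) set). t powr r + r * (t + R) powr (r - 1) * \<bar>Y $ fst a $ snd a\<bar>)"
    proof (rule sum_mono)
      fix a :: "'m \<times> 'n"
      let ?y = "\<bar>Y $ fst a $ snd a\<bar>"
      have "\<bar>(t *\<^sub>R J + Y) $ fst a $ snd a\<bar> powr r \<le> (t + ?y) powr r"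
        using assms by (intro powr_mono2) (auto simp: J_def)
      also have "\<dots> \<le> t powr r + r * ?y * (t + ?y) powr (r - 1)"
        using assms by (intro powr_add_le_tangent) auto
      also have "\<dots> \<le> t powr r + r * ?y * (t + R) powr (r - 1)"
        using assms Y by (intro add_left_mono mult_left_mono powr_mono2) auto
      finally show "\<bar>(t *\<^sub>R J + Y) $ fst a $ snd a\<bar> powr r
          \<le> t powr r + r * (t + R) powr (r - 1) * ?y" by (simp add: mult_ac)
    qed
    also have "\<dots> = k * t powr r + r * (t + R) powr (r - 1) * (\<Sum>a\<in>UNIV. \<bar>Y $ fst a $ snd a\<bar>)"
      by (simp add: sum.distrib k_def sum_distrib_left)
    also have "\<dots> \<le> k * t powr r + r * (t + R) powr (r - 1) * (k powr (1 - 1 / c) * R)"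
      using S assms by (intro add_left_mono mult_left_mono) auto
    also have "\<dots> = k * t powr r * (1 + r * u)"
      using k assms by (simp add: u_def distrib_left)
    finally have "F_norm (ennreal r) (t *\<^sub>R J + Y) \<le> (k * t powr r * (1 + r * u)) powr (1 / r)"
      using assms by (auto simp: F_norm_ennreal intro!: powr_mono2 sum_nonneg)
    also have "\<dots> = k powr (1 / r) * t * (1 + r * u) powr (1 / r)"
      using assms k \<open>0 \<le> u\<close> by (simp add: powr_mult powr_powr)
    also have "\<dots> \<le> k powr (1 / r) * t * (1 + r * u / r)"
      using assms k \<open>0 \<le> u\<close> by (intro mult_left_mono powr_inverse_le_tangent) auto
    also have "\<dots> = k powr (1 / r) * t + k powr (1 / r) * t * u"
      using assms by (simp add: distrib_left)
    also have "k powr (1 / r) * t * u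
        = (k powr (1 / r) * k powr (1 - 1 / c) / k) * R * ((t + R) powr (r - 1) * (t / t powr r))"
      by (simp add: u_def)
    also have "k powr (1 / r) * k powr (1 - 1 / c) / k = k powr (1 / r - 1 / c)"
      using k by (simp add: powr_diff)
    also have "t / t powr r = 1 / t powr (r - 1)" using assms by (simp add: powr_diff)
    also have "(t + R) powr (r - 1) * (1 / t powr (r - 1)) = ((t + R) / t) powr (r - 1)"
      using assms \<open>0 \<le> R\<close> by (simp add: powr_divide)
    finally show "F_norm (ennreal r) (t *\<^sub>R J + Y)
      \<le> k powr (1 / r) * t + k powr (1 / r - 1 / c) * R * ((t + R) / t) powr (r - 1)" .
  qed
qed

lemma lower_bound_gap_INF:
  fixes X :: "real^'n^'m"
  assumes "1 < r" "1 \<le> q" "ennreal r \<noteq> q" "0 \<le> l"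
  shows "(INF Z. worst_case (ennreal r) q l Z X -
    (F_norm (ennreal r) Z + l / delta (CARD('m) * CARD('n)) q (ennreal r) * F_norm (conj_exponent q) X)) = 0"
    (is "(INF Z. ?gap Z) = 0")
proof -
  define k where "k = CARD('m) * CARD('n)"
  have k: "1 \<le> k" by (simp add: k_def Suc_le_eq)
  define R where "R = l * F_norm (conj_exponent q) X"
  have "0 \<le> R" using assms by (simp add: R_def F_norm_nonneg)
  have r: "1 \<le> ennreal r" using assms by simp
  define d where "d = delta k q (ennreal r)"
  have d: "0 < d" unfolding d_def using assms r k by (intro delta_pos) auto
  have gap: "?gap Z = worst_case (ennreal r) q l Z X - F_norm (ennreal r) Z - R / d" for Z
    by (simp add: R_def d_def k_def)
  have nonneg: "0 \<le> ?gap Z" for Z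
    using worst_case_lower_bound[OF r assms(2,4), of Z X] by simp
  show ?thesis
  proof (cases "ennreal r < q")
    case True
    have "d \<le> 1" unfolding d_def using k r True by (intro delta_le_1) auto
    \<comment> \<open>The limiting increment \<open>R\<close> along the matrix unit is absorbed by
      the term \<open>R / d\<close> of the lower bound, leaving only the decaying part.\<close>
    then have Rd: "R \<le> R / d" using d \<open>0 \<le> R\<close> by (simp add: field_simps mult_left_le)
    \<comment> \<open>Any fixed position works; \<open>undefined\<close> merely names one.\<close>
    define g where "g = (\<lambda>t. t *\<^sub>R (axis undefined (axis undefined 1) :: real^'n^'m))"
    have "filterlim (\<lambda>t. R + t) at_top at_top"
      by (rule filterlim_tendsto_add_at_top[OF tendsto_const filterlim_ident])
    then have "filterlim (\<lambda>t. t + R) at_top at_top" by (simp add: add.commute)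
    then have "((\<lambda>t. (t + R) powr (1 - r)) \<longlongrightarrow> 0) at_top"
      using assms by (intro tendsto_neg_powr) auto
    then have "((\<lambda>t. k * R powr r * (t + R) powr (1 - r)) \<longlongrightarrow> 0) at_top"
      by (rule tendsto_mult_right_zero)
    moreover have "\<forall>\<^sub>F t in at_top. ?gap (g t) \<le> k * R powr r * (t + R) powr (1 - r)"
      using eventually_gt_at_top[of 0]
    proof eventually_elim
      case (elim t)
      have "F_norm (ennreal r) (g t) = t"
        unfolding g_def by (rule worst_case_matrix_unit(1)[OF assms(1,2,4) elim])
      then show ?case
        using worst_case_matrix_unit(2)[OF assms(1,2,4) elim, where i = undefined and j = undefined and X = X] Rd
        unfolding gap g_def by (simp add: R_def k_def)
    qed
    ultimately show ?thesis by (rule INF_eq_0_if_tendsto_0[OF nonneg])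
  next
    case False
    then have "q < ennreal r" using assms(3) by simp
    then obtain c where c: "q = ennreal c" "1 \<le> c" using assms(2) by (cases q) auto
    then have "c < r" using \<open>q < ennreal r\<close> by (simp add: ennreal_less_iff)
    \<comment> \<open>\<open>K\<close> is the reciprocal of the power mean bound on
      \<open>d\<close>, so the limiting increment \<open>K * R\<close> along the all-ones matrix is
      at most \<open>R / d\<close>.\<close>
    define K where "K = k powr (1 / r - 1 / c)"
    have "d \<le> k powr (1 / c - 1 / r)"
      unfolding d_def c(1) using k c(2) \<open>c < r\<close> by (intro delta_le_powr) auto
    then have "K * d \<le> K * k powr (1 / c - 1 / r)" by (intro mult_left_mono) (auto simp: K_def)
    also have "\<dots> = 1" using k by (simp add: K_def flip: powr_add)
    finally have "R * (K * d) \<le> R" using \<open>0 \<le> R\<close> by (intro mult_left_le) auto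
    then have Rd: "K * R \<le> R / d" using d by (simp add: field_simps)
    define g where "g = (\<lambda>t. t *\<^sub>R ((\<chi> i j. 1) :: real^'n^'m))"
    have "(inverse \<longlongrightarrow> (0 :: real)) at_top"
      by (rule tendsto_inverse_0_at_top[OF filterlim_ident])
    then have "((\<lambda>t. K * R * (1 + R * inverse t) powr (r - 1) - K * R) \<longlongrightarrow> K * R * (1 + R * 0) powr (r - 1) - K * R) at_top"
      by (intro tendsto_diff tendsto_mult tendsto_add tendsto_const tendsto_powr) auto
    then have "((\<lambda>t. K * R * (1 + R * inverse t) powr (r - 1) - K * R) \<longlongrightarrow> 0) at_top"
      by simp
    moreover have "\<forall>\<^sub>F t in at_top. ?gap (g t) \<le> K * R * (1 + R * inverse t) powr (r - 1) - K * R"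
      using eventually_gt_at_top[of 0]
    proof eventually_elim
      case (elim t)
      have "(t + R) / t = 1 + R * inverse t" using elim by (simp add: field_simps)
      moreover have "F_norm (ennreal r) (g t) = k powr (1 / r) * t"
        unfolding g_def k_def by (rule worst_case_all_ones(1)[OF assms(1) c(2) assms(4) elim])
      ultimately show ?case
        using worst_case_all_ones(2)[OF assms(1) c(2) assms(4) elim, of X] Rd
        unfolding gap g_def by (simp add: R_def k_def K_def c(1))
    qed
    ultimately show ?thesis by (rule INF_eq_0_if_tendsto_0[OF nonneg])
  qed
qed

text \<open>The first two conjuncts certify that the real supremum in \<open>worst_case\<close> is
  an attained maximum over the uncertainty set, as the middle expression of the inequality
  requires.\<close>

theorem proposition10:
  fixes p q :: ennreal and l :: real and X :: "real^'n^'m"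
  assumes "l > 0" and "1 \<le> p" and "1 \<le> q"
  shows
    "(\<forall>Z. (\<exists>D \<in> uncertainty_set q l. F_norm p (Z + D X) = worst_case p q l Z X) \<and>
          (\<forall>D \<in> uncertainty_set q l. F_norm p (Z + D X) \<le> worst_case p q l Z X) \<and>
          F_norm p Z + l / delta (CARD('m) * CARD('n)) q p * F_norm (conj_exponent q) X
            \<le> worst_case p q l Z X \<and>
          worst_case p q l Z X
            \<le> F_norm p Z + l * delta (CARD('m) * CARD('n)) p q * F_norm (conj_exponent q) X) \<and>
     (p \<noteq> q \<and> 1 < p \<and> p < \<infinity> \<and> CARD('m) * CARD('n) \<ge> 2 \<and> X \<noteq> 0 \<longrightarrow>
       (AE Z in lebesgue.
          worst_case p q l Z X
            < F_norm p Z + l * delta (CARD('m) * CARD('n)) p q * F_norm (conj_exponent q) X)) \<and>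
     (p \<noteq> q \<and> 1 < p \<and> p < \<infinity> \<longrightarrow>
       (INF Z. worst_case p q l Z X -
          (F_norm p Z + l / delta (CARD('m) * CARD('n)) q p * F_norm (conj_exponent q) X)) = 0)"
proof (intro conjI allI impI)
  fix Z :: "real^'n^'m"
  have l: "0 \<le> l" using assms(1) by simp
  \<comment> \<open>Carries attainment and maximality from perturbations \<open>Y\<close> in the
    ball back to linear maps \<open>D\<close>.\<close>
  have image: "(\<lambda>D. D X) ` uncertainty_set q l = {Y. F_norm q Y \<le> l * F_norm (conj_exponent q) X}"
    by (rule image_uncertainty_set[OF assms(3) l])
  show "\<exists>D \<in> uncertainty_set q l. F_norm p (Z + D X) = worst_case p q l Z X"
    using worst_case_attained(1)[OF assms(2,3) l, of X Z] image
    by (metis (mono_tags, lifting) image_iff mem_Collect_eq)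
  show "\<forall>D \<in> uncertainty_set q l. F_norm p (Z + D X) \<le> worst_case p q l Z X"
    using worst_case_attained(2)[OF assms(2,3) l, of _ X Z] image by blast
  show "F_norm p Z + l / delta (CARD('m) * CARD('n)) q p * F_norm (conj_exponent q) X
      \<le> worst_case p q l Z X"
    by (rule worst_case_lower_bound[OF assms(2,3) l])
  show "worst_case p q l Z X
      \<le> F_norm p Z + l * delta (CARD('m) * CARD('n)) p q * F_norm (conj_exponent q) X"
  proof (rule worst_case_le[OF assms(2,3) l])
    fix Y :: "real^'n^'m" assume "F_norm q Y \<le> l * F_norm (conj_exponent q) X"
    from F_norm_add_le[OF assms(2,3) this, of Z]
    show "F_norm p (Z + Y)
        \<le> F_norm p Z + l * delta (CARD('m) * CARD('n)) p q * F_norm (conj_exponent q) X"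
      by (simp add: mult_ac)
  qed
next
  assume *: "p \<noteq> q \<and> 1 < p \<and> p < \<infinity> \<and> CARD('m) * CARD('n) \<ge> 2 \<and> X \<noteq> 0"
  then obtain r where "p = ennreal r" "1 < r" by (cases p) auto
  with * assms show "AE Z in lebesgue. worst_case p q l Z X
      < F_norm p Z + l * delta (CARD('m) * CARD('n)) p q * F_norm (conj_exponent q) X"
    using worst_case_less_AE[of r q l X] by simp
next
  assume *: "p \<noteq> q \<and> 1 < p \<and> p < \<infinity>"
  then obtain r where "p = ennreal r" "1 < r" by (cases p) auto
  with * assms show "(INF Z. worst_case p q l Z X -
      (F_norm p Z + l / delta (CARD('m) * CARD('n)) q p * F_norm (conj_exponent q) X)) = 0"
    using lower_bound_gap_INF[of r q l X] by simp
qed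

end
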